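(* Let $k$ be a field, $S=k[x_1,\dots,x_n]$, and let $I\subset(x_1,\dots,x_n)^2$ be a monomial ideal that is stable or squarefree stable. Then $I$ admits a monomial basis in Koszul homology.
   Context: $G(I)$ is the set of minimal monomial generators of $I$; for a monomial $u$, $\operatorname{supp}(u)=\{i:x_i\mid u\}$ and $\max(u)=\max\operatorname{supp}(u)$. A monomial ideal $I$ is stable if for all $u\in G(I)$ and $i\le\max(u)$, $x_i\frac{u}{x_{\max(u)}}\in I$. A squarefree monomial ideal $I$ is squarefree stable if for all $u\in G(I)$ and all $i<\max(u)$ with $i\notin\operatorname{supp}(u)$, $x_i\frac{u}{x_{\max(u)}}\in I$. With $R=S/I$, $K^R$ is the Koszul complex of $R$ with respect to $x_1,\dots,x_n$, i.e. the exterior algebra of $R^n$ (basis $e_1,\dots,e_n$) with $\partial(e_i)=\bar x_i$ extended as a derivation. A monomial cycle is a cycle of the form $\bar u\,e_{\sigma_1}\wedge\dots\wedge e_{\sigma_p}$, where $\bar u$ is the image in $R$ of a monomial $u\in S$ and $\sigma_1<\dots<\sigma_p$. $I$ admits a monomial basis in Koszul homology if for all $1\le p\le n$, either $H_p(K^R)=0$ or $H_p(K^R)$ has a $k$-basis consisting of classes of monomial cycles. *)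

theory Defs
  imports
    "HOL-Algebra.Ideal_Product"
    "HOL-Algebra.QuotRing"
    "HOL-Library.Poly_Mapping"
    "Jordan_Normal_Form.VS_Connect"
begin

section \<open>Monomial ideals in a polynomial ring\<close>

text \<open>A polynomial is a finitely supported map from exponent vectors to coefficients, and
  \<open>k[x\<^sub>1,\<dots>,x\<^sub>n]\<close> consists of those involving only the variables with index in \<open>{1..n}\<close>.
  Throughout, a monomial is represented by its exponent vector \<open>u :: nat \<Rightarrow>\<^sub>0 nat\<close>, so products
  of monomials are sums of exponent vectors and \<open>supp(u)\<close> is \<open>Poly_Mapping.keys u\<close>.\<close>

type_synonym 'k mpoly = "(nat \<Rightarrow>\<^sub>0 nat) \<Rightarrow>\<^sub>0 'k"

definition monomials :: "nat \<Rightarrow> (nat \<Rightarrow>\<^sub>0 nat) set" where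
  "monomials n = {u. Poly_Mapping.keys u \<subseteq> {1..n}}"

definition xpow :: "(nat \<Rightarrow>\<^sub>0 nat) \<Rightarrow> 'k::field mpoly" where
  "xpow u = Poly_Mapping.single u 1"

abbreviation var :: "nat \<Rightarrow> (nat \<Rightarrow>\<^sub>0 nat)" where
  "var i \<equiv> Poly_Mapping.single i 1"

definition poly_ring :: "nat \<Rightarrow> 'k::field mpoly ring" where
  "poly_ring n =
    \<lparr>carrier = {f. Poly_Mapping.keys f \<subseteq> monomials n}, mult = (*), one = 1, zero = 0, add = (+)\<rparr>"

lemma poly_ring_simps [simp]:
  "carrier (poly_ring n) = {f. Poly_Mapping.keys f \<subseteq> monomials n}"
  "f \<otimes>\<^bsub>poly_ring n\<^esub> g = f * g" "f \<oplus>\<^bsub>poly_ring n\<^esub> g = f + g"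
  "\<one>\<^bsub>poly_ring n\<^esub> = 1" "\<zero>\<^bsub>poly_ring n\<^esub> = 0"
  by (simp_all add: poly_ring_def)

lemma zero_in_monomials [simp]: "0 \<in> monomials n"
  by (simp add: monomials_def)

lemma cring_poly_ring: "cring (poly_ring n :: 'k::field mpoly ring)"
proof -
  have mult: "Poly_Mapping.keys (f * g) \<subseteq> monomials n"
    if fg: "Poly_Mapping.keys f \<subseteq> monomials n" "Poly_Mapping.keys g \<subseteq> monomials n"
    for f g :: "'k mpoly"
  proof
    fix w assume "w \<in> Poly_Mapping.keys (f * g)"
    then obtain u v where "w = u + v" "u \<in> monomials n" "v \<in> monomials n"
      using Poly_Mapping.keys_mult[of f g] fg by blast
    then show "w \<in> monomials n"
      using Poly_Mapping.keys_add[of u v] by (auto simp: monomials_def)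
  qed
  show ?thesis
  proof (rule cringI)
    show "abelian_group (poly_ring n :: 'k mpoly ring)"
    proof (rule abelian_groupI)
      fix f :: "'k mpoly" assume "f \<in> carrier (poly_ring n)"
      then show "\<exists>g\<in>carrier (poly_ring n). g \<oplus>\<^bsub>poly_ring n\<^esub> f = \<zero>\<^bsub>poly_ring n\<^esub>"
        by (intro bexI[of _ "- f"]) auto
    qed (use Poly_Mapping.keys_add in \<open>fastforce simp: algebra_simps\<close>)+
    show "Group.comm_monoid (poly_ring n :: 'k mpoly ring)"
      by (rule comm_monoidI) (use mult in \<open>auto simp: algebra_simps zero_in_monomials\<close>)
  qed (auto simp: algebra_simps)
qed

definition max_ideal :: "nat \<Rightarrow> 'k::field mpoly set" where
  "max_ideal n = Idl\<^bsub>poly_ring n\<^esub> ((\<lambda>i. xpow (var i)) ` {1..n})"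

definition monomial_ideal :: "nat \<Rightarrow> 'k::field mpoly set \<Rightarrow> bool" where
  "monomial_ideal n I \<longleftrightarrow> (\<exists>M\<subseteq>monomials n. I = Idl\<^bsub>poly_ring n\<^esub> (xpow ` M))"

definition squarefree_mon :: "(nat \<Rightarrow>\<^sub>0 nat) \<Rightarrow> bool" where
  "squarefree_mon u \<longleftrightarrow> (\<forall>i. Poly_Mapping.lookup u i \<le> 1)"

definition squarefree_monomial_ideal :: "nat \<Rightarrow> 'k::field mpoly set \<Rightarrow> bool" where
  "squarefree_monomial_ideal n I \<longleftrightarrow>
    (\<exists>M\<subseteq>monomials n. (\<forall>u\<in>M. squarefree_mon u) \<and> I = Idl\<^bsub>poly_ring n\<^esub> (xpow ` M))"

text \<open>\<open>G(I)\<close>: the monomials in \<open>I\<close> that are minimal with respect to divisibility. The order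
  on \<^typ>\<open>nat \<Rightarrow>\<^sub>0 nat\<close> provided by the library is lexicographic, so divisibility is spelled out.\<close>

definition min_gens :: "nat \<Rightarrow> 'k::field mpoly set \<Rightarrow> (nat \<Rightarrow>\<^sub>0 nat) set" where
  "min_gens n I =
    {u \<in> monomials n. xpow u \<in> I \<and>
      (\<forall>v\<in>monomials n. xpow v \<in> I \<and> (\<exists>w. u = v + w) \<longrightarrow> v = u)}"

lemma xpow_in_poly_ring: "u \<in> monomials n \<Longrightarrow> xpow u \<in> carrier (poly_ring n)"
  by (simp add: xpow_def)

lemma mem_monomial_ideal_keys:
  assumes M: "M \<subseteq> monomials n" and f: "(f :: 'k::field mpoly) \<in> Idl\<^bsub>poly_ring n\<^esub> (xpow ` M)"
    and k: "k \<in> Poly_Mapping.keys f"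
  shows "\<exists>m\<in>M. \<exists>w. k = m + w"
proof -
  interpret S: cring "poly_ring n :: 'k mpoly ring" by (rule cring_poly_ring)
  let ?J = "{f \<in> carrier (poly_ring n :: 'k mpoly ring). \<forall>k\<in>Poly_Mapping.keys f. \<exists>m\<in>M. \<exists>w. k = m + w}"
  have mult: "h * f \<in> ?J" if f: "f \<in> ?J" and h: "h \<in> carrier (poly_ring n)" for f h :: "'k mpoly"
  proof -
    have "\<exists>m\<in>M. \<exists>w. k = m + w" if k: "k \<in> Poly_Mapping.keys (h * f)" for k
    proof -
      obtain a b where ab: "k = a + b" "b \<in> Poly_Mapping.keys f"
        using k Poly_Mapping.keys_mult[of h f] by blast
      then obtain m w where "m \<in> M" "b = m + w" using f by blast
      with ab have "k = m + (a + w)" by (simp add: ac_simps)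
      with \<open>m \<in> M\<close> show ?thesis by blast
    qed
    moreover have "h * f \<in> carrier (poly_ring n)" using S.m_closed[of h f] f h by simp
    ultimately show ?thesis by blast
  qed
  have "ideal ?J (poly_ring n)"
  proof (rule idealI)
    show "subgroup ?J (add_monoid (poly_ring n :: 'k mpoly ring))"
    proof (rule S.add.subgroupI)
      fix f :: "'k mpoly" assume f: "f \<in> ?J"
      have "\<ominus>\<^bsub>poly_ring n\<^esub> f = - f"
        by (rule S.minus_equality) (use f in auto)
      then show "\<ominus>\<^bsub>poly_ring n\<^esub> f \<in> ?J" using f by simp
    next
      fix f g :: "'k mpoly" assume "f \<in> ?J" "g \<in> ?J"
      then show "f \<oplus>\<^bsub>poly_ring n\<^esub> g \<in> ?J"
        using Poly_Mapping.keys_add[of f g] by auto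
    qed (auto intro: exI[of _ 0])
  qed (use mult in \<open>auto simp: S.ring_axioms mult.commute\<close>)
  moreover have "xpow ` M \<subseteq> ?J"
    using M by (auto simp: xpow_def intro!: bexI exI[of _ 0])
  ultimately have "Idl\<^bsub>poly_ring n\<^esub> (xpow ` M) \<subseteq> ?J" by (rule S.genideal_minimal)
  with f k show ?thesis by blast
qed

text \<open>\<^const>\<open>min_gens\<close> is the least set of monomials generating \<open>I\<close>.\<close>

lemma min_gens_least:
  assumes "M \<subseteq> monomials n" "(I :: 'k::field mpoly set) = Idl\<^bsub>poly_ring n\<^esub> (xpow ` M)"
  shows "min_gens n I \<subseteq> M"
proof
  interpret S: cring "poly_ring n :: 'k mpoly ring" by (rule cring_poly_ring)
  fix u assume u: "u \<in> min_gens n I"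
  then have "xpow u \<in> I" by (simp add: min_gens_def)
  then obtain m w where m: "m \<in> M" "u = m + w"
    using mem_monomial_ideal_keys[OF assms(1), of "xpow u" u] assms(2) by (auto simp: xpow_def)
  moreover have "xpow m \<in> I"
    using m(1) assms S.genideal_self[of "xpow ` M"] xpow_in_poly_ring by blast
  ultimately show "u \<in> M" using u assms(1) by (auto simp: min_gens_def)
qed

lemma Idl_min_gens:
  assumes I: "monomial_ideal n (I :: 'k::field mpoly set)"
  shows "Idl\<^bsub>poly_ring n\<^esub> (xpow ` min_gens n I) = I"
proof -
  interpret S: cring "poly_ring n :: 'k mpoly ring" by (rule cring_poly_ring)
  obtain M where M: "M \<subseteq> monomials n" "I = Idl\<^bsub>poly_ring n\<^esub> (xpow ` M)"
    using I by (auto simp: monomial_ideal_def)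
  have carr: "xpow ` A \<subseteq> carrier (poly_ring n :: 'k mpoly ring)" if "A \<subseteq> monomials n" for A
    using that xpow_in_poly_ring by blast
  have G: "min_gens n I \<subseteq> monomials n" by (auto simp: min_gens_def)
  let ?J = "Idl\<^bsub>poly_ring n\<^esub> (xpow ` min_gens n I) :: 'k mpoly set"
  have idI: "ideal I (poly_ring n)" unfolding M(2) by (rule S.genideal_ideal[OF carr[OF M(1)]])
  interpret J: ideal ?J "poly_ring n" by (rule S.genideal_ideal[OF carr[OF G]])
  have mem: "xpow u \<in> ?J" if "u \<in> monomials n" "xpow u \<in> I" for u
    using that
  proof (induction "\<Sum>i\<in>{1..n}. Poly_Mapping.lookup u i" arbitrary: u rule: less_induct)
    case less
    show ?case
    proof (cases "u \<in> min_gens n I")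
      case True
      then show ?thesis using S.genideal_self[OF carr[OF G]] by blast
    next
      case False
      then obtain v w where v: "v \<in> monomials n" "xpow v \<in> I" "u = v + w" "v \<noteq> u"
        using less.prems by (auto simp: min_gens_def)
      have "Poly_Mapping.keys w \<subseteq> Poly_Mapping.keys u"
        using v(3) by (auto simp: in_keys_iff lookup_add)
      then have w: "w \<in> monomials n" using less.prems by (auto simp: monomials_def)
      have "w \<noteq> 0" using v by auto
      then obtain i where i: "Poly_Mapping.lookup w i > 0" "i \<in> Poly_Mapping.keys w"
        by (metis gr_zeroI in_keys_iff poly_mapping_eqI lookup_zero)
      have "i \<in> {1..n}" using i w by (auto simp: monomials_def)
      then have "(\<Sum>i\<in>{1..n}. Poly_Mapping.lookup v i) < (\<Sum>i\<in>{1..n}. Poly_Mapping.lookup u i)"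
        using i v(3) by (intro sum_strict_mono_ex1) (auto simp: lookup_add)
      then have "xpow v \<in> ?J" using less.hyps v by blast
      then have "xpow w \<otimes>\<^bsub>poly_ring n\<^esub> xpow v \<in> ?J"
        using xpow_in_poly_ring[OF w] by (rule J.I_l_closed)
      then show ?thesis by (simp add: v(3) xpow_def mult_single add.commute)
    qed
  qed
  have "xpow ` M \<subseteq> I" unfolding M(2) by (rule S.genideal_self[OF carr[OF M(1)]])
  then have "xpow ` M \<subseteq> ?J" using mem M(1) by blast
  then have "I \<subseteq> ?J" by (subst M(2)) (rule S.genideal_minimal[OF J.is_ideal])
  moreover have "?J \<subseteq> I"
    by (rule S.genideal_minimal[OF idI]) (auto simp: min_gens_def)
  ultimately show ?thesis by blast
qed

definition max_var :: "(nat \<Rightarrow>\<^sub>0 nat) \<Rightarrow> nat" where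
  "max_var u = Max (Poly_Mapping.keys u)"

text \<open>For \<open>I \<noteq> S\<close> the monomial 1 is not in \<open>G(I)\<close>, so \<^const>\<open>max_var\<close> is only applied to
  monomials with nonempty support, and the subtraction of exponent vectors is exact division.\<close>

definition stable_ideal :: "nat \<Rightarrow> 'k::field mpoly set \<Rightarrow> bool" where
  "stable_ideal n I \<longleftrightarrow> monomial_ideal n I \<and>
    (\<forall>u\<in>min_gens n I. \<forall>i\<in>{1..n}. i \<le> max_var u \<longrightarrow>
      xpow (var i + (u - var (max_var u))) \<in> I)"

definition squarefree_stable_ideal :: "nat \<Rightarrow> 'k::field mpoly set \<Rightarrow> bool" where
  "squarefree_stable_ideal n I \<longleftrightarrow> squarefree_monomial_ideal n I \<and>
    (\<forall>u\<in>min_gens n I. \<forall>i\<in>{1..n}. i < max_var u \<and> i \<notin> Poly_Mapping.keys u \<longrightarrow>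
      xpow (var i + (u - var (max_var u))) \<in> I)"


section \<open>Modules\<close>

text \<open>The \<open>mult\<close> and \<open>one\<close> fields of an HOL-Algebra module record are not used.\<close>

definition quot_module :: "('a, 'b, 'c) module_scheme \<Rightarrow> 'b set \<Rightarrow> ('a, 'b set) module" where
  "quot_module M N =
    \<lparr>carrier = a_rcosets\<^bsub>M\<^esub> N, mult = undefined, one = undefined, zero = N, add = set_add M,
     smult = (\<lambda>r X. \<Union>x\<in>X. N +>\<^bsub>M\<^esub> (r \<odot>\<^bsub>M\<^esub> x))\<rparr>"

definition restrict_scalars :: "('c \<Rightarrow> 'a) \<Rightarrow> ('a, 'b, 'd) module_scheme \<Rightarrow> ('c, 'b) module" where
  "restrict_scalars \<phi> M =
    \<lparr>carrier = carrier M, mult = mult M, one = one M, zero = zero M, add = add M,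
     smult = (\<lambda>c x. \<phi> c \<odot>\<^bsub>M\<^esub> x)\<rparr>"


lemma quot_module_module:
  assumes M: "Module.module R M" and N: "Module.submodule N R M"
  shows "Module.module R (quot_module M N)"
proof -
  interpret Module.module R M by (rule M)
  interpret N: Module.submodule N R M by (rule N)
  interpret N: abelian_subgroup N M
    by (intro abelian_subgroupI3 additive_subgroup.intro N.subgroup_axioms abelian_group_axioms)
  have smult: "(\<Union>y\<in>N +>\<^bsub>M\<^esub> x. N +>\<^bsub>M\<^esub> (r \<odot>\<^bsub>M\<^esub> y)) = N +>\<^bsub>M\<^esub> (r \<odot>\<^bsub>M\<^esub> x)"
    if "r \<in> carrier R" "x \<in> carrier M" for r x
  proof -
    have "N +>\<^bsub>M\<^esub> (r \<odot>\<^bsub>M\<^esub> y) = N +>\<^bsub>M\<^esub> (r \<odot>\<^bsub>M\<^esub> x)" if y: "y \<in> N +>\<^bsub>M\<^esub> x" for y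
    proof -
      obtain h where h: "h \<in> N" "y = h \<oplus>\<^bsub>M\<^esub> x"
        using y by (auto simp: a_r_coset_def r_coset_def)
      have hM: "h \<in> carrier M" using h N.a_subset by auto
      have "r \<odot>\<^bsub>M\<^esub> y = r \<odot>\<^bsub>M\<^esub> h \<oplus>\<^bsub>M\<^esub> r \<odot>\<^bsub>M\<^esub> x"
        using h hM \<open>r \<in> carrier R\<close> \<open>x \<in> carrier M\<close> by (simp add: smult_r_distr)
      moreover have "r \<odot>\<^bsub>M\<^esub> h \<in> N" using h \<open>r \<in> carrier R\<close> by simp
      ultimately have "r \<odot>\<^bsub>M\<^esub> y \<in> N +>\<^bsub>M\<^esub> (r \<odot>\<^bsub>M\<^esub> x)"
        by (auto simp: a_r_coset_def r_coset_def)
      then show ?thesis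
        using \<open>r \<in> carrier R\<close> \<open>x \<in> carrier M\<close> N.a_repr_independence' by (metis smult_closed)
    qed
    moreover have "x \<in> N +>\<^bsub>M\<^esub> x" using \<open>x \<in> carrier M\<close> by (rule N.a_rcos_self)
    ultimately show ?thesis by blast
  qed
  have add: "(N +>\<^bsub>M\<^esub> x) <+>\<^bsub>M\<^esub> (N +>\<^bsub>M\<^esub> y) = N +>\<^bsub>M\<^esub> (x \<oplus>\<^bsub>M\<^esub> y)"
    if "x \<in> carrier M" "y \<in> carrier M" for x y
    using that by (rule N.a_rcos_sum)
  have zero: "N = N +>\<^bsub>M\<^esub> \<zero>\<^bsub>M\<^esub>"
    by (simp add: N.a_subset)
  have carr: "carrier (quot_module M N) = (\<lambda>x. N +>\<^bsub>M\<^esub> x) ` carrier M"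
    by (auto simp: quot_module_def A_RCOSETS_def' a_r_coset_def')
  have ops: "X \<oplus>\<^bsub>quot_module M N\<^esub> Y = X <+>\<^bsub>M\<^esub> Y" "\<zero>\<^bsub>quot_module M N\<^esub> = N +>\<^bsub>M\<^esub> \<zero>\<^bsub>M\<^esub>"
    for X Y
    using zero by (simp_all add: quot_module_def)
  have smult_coset: "r \<odot>\<^bsub>quot_module M N\<^esub> (N +>\<^bsub>M\<^esub> x) = N +>\<^bsub>M\<^esub> (r \<odot>\<^bsub>M\<^esub> x)"
    if "r \<in> carrier R" "x \<in> carrier M" for r x
    using smult[OF that] by (simp add: quot_module_def)
  show ?thesis
  proof (rule moduleI)
    show "abelian_group (quot_module M N)"
    proof (rule abelian_groupI)
      fix X assume "X \<in> carrier (quot_module M N)"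
      then obtain x where x: "x \<in> carrier M" "X = N +>\<^bsub>M\<^esub> x"
        unfolding carr by blast
      then have "(N +>\<^bsub>M\<^esub> (\<ominus>\<^bsub>M\<^esub> x)) \<oplus>\<^bsub>quot_module M N\<^esub> X = \<zero>\<^bsub>quot_module M N\<^esub>"
        by (simp only: ops add M.a_inv_closed M.l_neg)
      then show "\<exists>Y\<in>carrier (quot_module M N). Y \<oplus>\<^bsub>quot_module M N\<^esub> X = \<zero>\<^bsub>quot_module M N\<^esub>"
        unfolding carr using x by blast
    qed (auto simp: carr ops add M.a_ac)
  qed (auto simp: carr ops smult_coset add smult_l_distr smult_r_distr smult_assoc1 R.cring_axioms)
qed

lemma restrict_scalars_module:
  assumes M: "Module.module R M" and K: "cring K" and \<phi>: "\<phi> \<in> Ring.ring_hom K R"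
  shows "Module.module K (restrict_scalars \<phi> M)"
proof -
  interpret Module.module R M by (rule M)
  have "abelian_group (restrict_scalars \<phi> M)"
  proof (rule abelian_groupI)
    fix x assume "x \<in> carrier (restrict_scalars \<phi> M)"
    then show "\<exists>y\<in>carrier (restrict_scalars \<phi> M).
        y \<oplus>\<^bsub>restrict_scalars \<phi> M\<^esub> x = \<zero>\<^bsub>restrict_scalars \<phi> M\<^esub>"
      by (intro bexI[of _ "\<ominus>\<^bsub>M\<^esub> x"]) (auto simp: restrict_scalars_def M.l_neg)
  qed (auto simp: restrict_scalars_def M.a_ac)
  then show ?thesis
    using K by (intro moduleI)
      (auto simp: restrict_scalars_def smult_l_distr smult_r_distr smult_assoc1
        ring_hom_closed[OF \<phi>] ring_hom_add[OF \<phi>] ring_hom_mult[OF \<phi>] ring_hom_one[OF \<phi>])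
qed


section \<open>The Koszul complex\<close>

text \<open>The component \<open>K\<^sub>p = \<Lambda>\<^sup>p R\<^sup>n\<close> is the free \<open>R\<close>-module on the elements
  \<open>e\<^sub>\<sigma> = e\<^bsub>\<sigma>1\<^esub> \<and> \<dots> \<and> e\<^bsub>\<sigma>p\<^esub>\<close>, \<open>\<sigma>1 < \<dots> < \<sigma>p\<close>, indexed by the \<open>p\<close>-element subsets
  \<open>\<sigma> = {\<sigma>1,\<dots>,\<sigma>p}\<close> of \<open>{1..n}\<close>; a chain is given by its coordinates in this basis.\<close>

definition faces :: "nat \<Rightarrow> nat \<Rightarrow> nat set set" where
  "faces n p = {\<sigma>. \<sigma> \<subseteq> {1..n} \<and> card \<sigma> = p}"

definition koszul_module :: "('a, 'b) ring_scheme \<Rightarrow> nat \<Rightarrow> nat \<Rightarrow> ('a, nat set \<Rightarrow> 'a) module" where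
  "koszul_module R n p =
    \<lparr>carrier = faces n p \<rightarrow>\<^sub>E carrier R, mult = undefined, one = undefined,
     zero = (\<lambda>\<sigma>\<in>faces n p. \<zero>\<^bsub>R\<^esub>),
     add = (\<lambda>f g. \<lambda>\<sigma>\<in>faces n p. f \<sigma> \<oplus>\<^bsub>R\<^esub> g \<sigma>),
     smult = (\<lambda>r f. \<lambda>\<sigma>\<in>faces n p. r \<otimes>\<^bsub>R\<^esub> f \<sigma>)\<rparr>"

text \<open>The chain \<open>a e\<^sub>\<sigma>\<close>, for \<open>\<sigma>\<close> in \<^term>\<open>faces n p\<close>.\<close>

definition koszul_elem :: "('a, 'b) ring_scheme \<Rightarrow> nat \<Rightarrow> nat \<Rightarrow> 'a \<Rightarrow> nat set \<Rightarrow> (nat set \<Rightarrow> 'a)" where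
  "koszul_elem R n p a \<sigma> = (\<lambda>\<tau>\<in>faces n p. if \<tau> = \<sigma> then a else \<zero>\<^bsub>R\<^esub>)"

text \<open>\<open>koszul_sgn R i \<tau>\<close> is the sign in \<open>e\<^sub>i \<and> e\<^sub>\<tau> = \<plusminus> e\<^bsub>\<tau> \<union> {i}\<^esub>\<close> for \<open>i \<notin> \<tau>\<close>.\<close>

definition koszul_sgn :: "('a, 'b) ring_scheme \<Rightarrow> nat \<Rightarrow> nat set \<Rightarrow> 'a" where
  "koszul_sgn R i \<tau> = (\<ominus>\<^bsub>R\<^esub> \<one>\<^bsub>R\<^esub>) [^]\<^bsub>R\<^esub> card {j \<in> \<tau>. j < i}"

text \<open>The differential \<open>K\<^bsub>p+1\<^esub> \<rightarrow> K\<^sub>p\<close>,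
  \<open>e\<^bsub>\<sigma>1\<^esub> \<and> \<dots> \<and> e\<^bsub>\<sigma>(p+1)\<^esub> \<mapsto> \<Sum>\<^sub>r (-1)\<^bsup>r-1\<^esup> x\<^bsub>\<sigma>r\<^esub> e\<^bsub>\<sigma>1\<^esub> \<and> \<dots> (omit e\<^bsub>\<sigma>r\<^esub>) \<dots> \<and> e\<^bsub>\<sigma>(p+1)\<^esub>\<close>,
  in coordinates. It is the derivation extending \<open>e\<^sub>i \<mapsto> x\<^sub>i\<close>: see \<open>koszul_diff_wedge\<close> below.\<close>

definition koszul_diff ::
  "('a, 'b) ring_scheme \<Rightarrow> (nat \<Rightarrow> 'a) \<Rightarrow> nat \<Rightarrow> nat \<Rightarrow> (nat set \<Rightarrow> 'a) \<Rightarrow> (nat set \<Rightarrow> 'a)" where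
  "koszul_diff R x n p f =
    (\<lambda>\<tau>\<in>faces n p. \<Oplus>\<^bsub>R\<^esub>i\<in>{1..n} - \<tau>. koszul_sgn R i \<tau> \<otimes>\<^bsub>R\<^esub> (x i \<otimes>\<^bsub>R\<^esub> f (insert i \<tau>)))"

definition koszul_cycles ::
  "('a, 'b) ring_scheme \<Rightarrow> (nat \<Rightarrow> 'a) \<Rightarrow> nat \<Rightarrow> nat \<Rightarrow> (nat set \<Rightarrow> 'a) set" where
  "koszul_cycles R x n p =
    {f \<in> carrier (koszul_module R n p).
      \<forall>q. p = Suc q \<longrightarrow> koszul_diff R x n q f = \<zero>\<^bsub>koszul_module R n q\<^esub>}"

definition koszul_boundaries ::
  "('a, 'b) ring_scheme \<Rightarrow> (nat \<Rightarrow> 'a) \<Rightarrow> nat \<Rightarrow> nat \<Rightarrow> (nat set \<Rightarrow> 'a) set" where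
  "koszul_boundaries R x n p = koszul_diff R x n p ` carrier (koszul_module R n (Suc p))"

definition koszul_cycle_module ::
  "('a, 'b) ring_scheme \<Rightarrow> (nat \<Rightarrow> 'a) \<Rightarrow> nat \<Rightarrow> nat \<Rightarrow> ('a, nat set \<Rightarrow> 'a) module" where
  "koszul_cycle_module R x n p = koszul_module R n p \<lparr>carrier := koszul_cycles R x n p\<rparr>"

definition koszul_homology ::
  "('a, 'b) ring_scheme \<Rightarrow> (nat \<Rightarrow> 'a) \<Rightarrow> nat \<Rightarrow> nat \<Rightarrow> ('a, (nat set \<Rightarrow> 'a) set) module" where
  "koszul_homology R x n p =
    quot_module (koszul_cycle_module R x n p) (koszul_boundaries R x n p)"

definition koszul_class ::
  "('a, 'b) ring_scheme \<Rightarrow> (nat \<Rightarrow> 'a) \<Rightarrow> nat \<Rightarrow> nat \<Rightarrow> (nat set \<Rightarrow> 'a) \<Rightarrow> (nat set \<Rightarrow> 'a) set" where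
  "koszul_class R x n p z =
    koszul_boundaries R x n p +>\<^bsub>koszul_cycle_module R x n p\<^esub> z"


text \<open>Left multiplication \<open>e\<^sub>i \<and> _ : K\<^sub>p \<rightarrow> K\<^bsub>p+1\<^esub>\<close> in coordinates. The lemmas below show that
  \<open>e\<^sub>\<sigma>\<close> is the ordered wedge product of the \<open>e\<^sub>i\<close>, \<open>i \<in> \<sigma>\<close>, and that
  \<open>\<partial>(e\<^sub>i \<and> f) = x\<^sub>i f - e\<^sub>i \<and> \<partial>f\<close>.\<close>

definition koszul_wedge ::
  "('a, 'b) ring_scheme \<Rightarrow> nat \<Rightarrow> nat \<Rightarrow> nat \<Rightarrow> (nat set \<Rightarrow> 'a) \<Rightarrow> (nat set \<Rightarrow> 'a)" where
  "koszul_wedge R n p i f = (\<lambda>\<tau>\<in>faces n (Suc p).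
     if i \<in> \<tau> then koszul_sgn R i (\<tau> - {i}) \<otimes>\<^bsub>R\<^esub> f (\<tau> - {i}) else \<zero>\<^bsub>R\<^esub>)"

lemma koszul_module_simps [simp]:
  "carrier (koszul_module R n p) = faces n p \<rightarrow>\<^sub>E carrier R"
  "f \<oplus>\<^bsub>koszul_module R n p\<^esub> g = (\<lambda>\<sigma>\<in>faces n p. f \<sigma> \<oplus>\<^bsub>R\<^esub> g \<sigma>)"
  "\<zero>\<^bsub>koszul_module R n p\<^esub> = (\<lambda>\<sigma>\<in>faces n p. \<zero>\<^bsub>R\<^esub>)"
  "r \<odot>\<^bsub>koszul_module R n p\<^esub> f = (\<lambda>\<sigma>\<in>faces n p. r \<otimes>\<^bsub>R\<^esub> f \<sigma>)"
  by (simp_all add: koszul_module_def)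

lemma faces_insert: "i \<in> {1..n} - \<tau> \<Longrightarrow> \<tau> \<in> faces n p \<Longrightarrow> insert i \<tau> \<in> faces n (Suc p)"
  by (auto simp: faces_def card_insert_if finite_subset[OF _ finite_atLeastAtMost])

lemma faces_remove: "i \<in> \<tau> \<Longrightarrow> \<tau> \<in> faces n (Suc p) \<Longrightarrow> \<tau> - {i} \<in> faces n p"
  by (auto simp: faces_def finite_subset[OF _ finite_atLeastAtMost])

context cring
begin

lemma koszul_module_module: "module R (koszul_module R n p)"
proof (rule moduleI)
  show "cring R" by (rule cring_axioms)
  show "abelian_group (koszul_module R n p)"
  proof (rule abelian_groupI)
    fix f assume "f \<in> carrier (koszul_module R n p)"
    then show "\<exists>g\<in>carrier (koszul_module R n p).
        g \<oplus>\<^bsub>koszul_module R n p\<^esub> f = \<zero>\<^bsub>koszul_module R n p\<^esub>"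
      by (intro bexI[of _ "\<lambda>\<sigma>\<in>faces n p. \<ominus> f \<sigma>"])
        (auto simp: PiE_iff l_neg intro!: restrict_ext)
  qed (auto simp: PiE_iff fun_eq_iff extensional_def a_ac)
qed (auto simp: PiE_iff fun_eq_iff extensional_def l_distr r_distr m_assoc)

lemma koszul_sgn_closed [simp, intro]: "koszul_sgn R i \<tau> \<in> carrier R"
  by (simp add: koszul_sgn_def)

lemma koszul_sgn_square: "koszul_sgn R i \<tau> \<otimes> koszul_sgn R i \<tau> = \<one>"
proof -
  have "(\<ominus> \<one>) [^] k \<otimes> (\<ominus> \<one>) [^] k = \<one>" for k :: nat
  proof -
    have "(\<ominus> \<one>) [^] k \<otimes> (\<ominus> \<one>) [^] k = ((\<ominus> \<one>) \<otimes> (\<ominus> \<one>)) [^] k"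
      by (simp add: pow_mult_distrib m_comm)
    also have "(\<ominus> \<one>) \<otimes> (\<ominus> \<one>) = \<one>"
      by (simp add: l_minus)
    finally show ?thesis by simp
  qed
  then show ?thesis by (simp add: koszul_sgn_def)
qed

lemma koszul_sgn_insert:
  assumes "finite \<tau>" "j \<notin> \<tau>"
  shows "koszul_sgn R i (insert j \<tau>) = (if j < i then \<ominus> koszul_sgn R i \<tau> else koszul_sgn R i \<tau>)"
proof -
  have "{k \<in> insert j \<tau>. k < i} = (if j < i then insert j {k \<in> \<tau>. k < i} else {k \<in> \<tau>. k < i})"
    by auto
  then show ?thesis
    using assms by (auto simp: koszul_sgn_def r_minus)
qed

lemma koszul_sgn_swap:
  assumes "finite \<tau>" "i \<notin> \<tau>" "j \<notin> \<tau>" "i \<noteq> j"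
  shows "koszul_sgn R i \<tau> \<otimes> koszul_sgn R j (insert i \<tau>) =
    \<ominus> (koszul_sgn R j \<tau> \<otimes> koszul_sgn R i (insert j \<tau>))"
  using assms by (cases i j rule: linorder_cases)
    (auto simp: koszul_sgn_insert m_comm l_minus r_minus)

lemma koszul_diff_closed:
  assumes "x \<in> {1..n} \<rightarrow> carrier R" "f \<in> faces n (Suc p) \<rightarrow>\<^sub>E carrier R"
  shows "koszul_diff R x n p f \<in> faces n p \<rightarrow>\<^sub>E carrier R"
  using assms faces_insert[of _ n _ p] by (fastforce simp: koszul_diff_def intro!: finsum_closed)

lemma finsum_antisym:
  assumes "finite A" "\<And>i j. i \<in> A \<Longrightarrow> j \<in> A \<Longrightarrow> g i j \<in> carrier R"
    and "\<And>i. i \<in> A \<Longrightarrow> g i i = \<zero>"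
    and "\<And>i j. i \<in> A \<Longrightarrow> j \<in> A \<Longrightarrow> i \<noteq> j \<Longrightarrow> g i j = \<ominus> g j i"
  shows "(\<Oplus>i\<in>A. \<Oplus>j\<in>A. g i j) = \<zero>"
  using assms
proof (induction A rule: finite_induct)
  case (insert a A)
  have cl: "g i j \<in> carrier R" if "i \<in> insert a A" "j \<in> insert a A" for i j
    using insert.prems(1) that by blast
  have "(\<Oplus>i\<in>insert a A. \<Oplus>j\<in>insert a A. g i j)
      = (g a a \<oplus> (\<Oplus>j\<in>A. g a j)) \<oplus> (\<Oplus>i\<in>A. g i a \<oplus> (\<Oplus>j\<in>A. g i j))"
    using insert.hyps cl by (simp add: finsum_insert Pi_def a_ac cong: finsum_cong)
  also have "(\<Oplus>i\<in>A. g i a \<oplus> (\<Oplus>j\<in>A. g i j)) = (\<Oplus>i\<in>A. g i a) \<oplus> (\<Oplus>i\<in>A. \<Oplus>j\<in>A. g i j)"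
    using cl by (subst finsum_addf) (auto simp: Pi_def)
  also have "(\<Oplus>i\<in>A. \<Oplus>j\<in>A. g i j) = \<zero>"
    by (rule insert.IH) (use insert.prems in blast)+
  also have "g a a = \<zero>" using insert.prems by auto
  finally have *: "(\<Oplus>i\<in>insert a A. \<Oplus>j\<in>insert a A. g i j)
      = (\<Oplus>j\<in>A. g a j) \<oplus> (\<Oplus>i\<in>A. g i a)"
    using cl by (simp add: Pi_def)
  also have "\<dots> = (\<Oplus>j\<in>A. g a j \<oplus> g j a)"
    using cl by (subst finsum_addf) (auto simp: Pi_def)
  also have "\<dots> = (\<Oplus>j\<in>A. \<zero>)"
  proof (rule finsum_cong')
    fix j assume j: "j \<in> A"
    then have "g a j = \<ominus> g j a" using insert.hyps insert.prems(3)[of a j] by blast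
    then show "g a j \<oplus> g j a = \<zero>" using j cl by (simp add: l_neg)
  qed auto
  finally show ?case by simp
next
  case empty
  show ?case by simp
qed

lemma koszul_diff_diff:
  assumes x: "x \<in> {1..n} \<rightarrow> carrier R" and f: "f \<in> faces n (Suc (Suc p)) \<rightarrow>\<^sub>E carrier R"
  shows "koszul_diff R x n p (koszul_diff R x n (Suc p) f) = (\<lambda>\<tau>\<in>faces n p. \<zero>)"
proof
  fix \<tau>
  show "koszul_diff R x n p (koszul_diff R x n (Suc p) f) \<tau> = (\<lambda>\<tau>\<in>faces n p. \<zero>) \<tau>"
  proof (cases "\<tau> \<in> faces n p")
    case \<tau>: True
    then have fin: "finite \<tau>"
      by (auto simp: faces_def finite_subset[OF _ finite_atLeastAtMost])
    let ?A = "{1..n} - \<tau>"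
    define c where "c i j = (koszul_sgn R i \<tau> \<otimes> koszul_sgn R j (insert i \<tau>)) \<otimes>
        (x i \<otimes> x j \<otimes> f (insert j (insert i \<tau>)))" for i j
    define g where "g i j = (if i = j then \<zero> else c i j)" for i j
    have fcl: "f (insert j (insert i \<tau>)) \<in> carrier R" if "i \<in> ?A" "j \<in> ?A" "i \<noteq> j" for i j
      using f faces_insert[OF _ faces_insert[OF that(1) \<tau>], of j] that by auto
    have xcl: "x i \<in> carrier R" if "i \<in> ?A" for i using x that by auto
    have ccl: "c i j \<in> carrier R" if "i \<in> ?A" "j \<in> ?A" "i \<noteq> j" for i j
      using that fcl xcl by (simp add: c_def)
    have "koszul_diff R x n p (koszul_diff R x n (Suc p) f) \<tau>
        = (\<Oplus>i\<in>?A. koszul_sgn R i \<tau> \<otimes> (x i \<otimes> (\<Oplus>j\<in>{1..n} - insert i \<tau>.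
            koszul_sgn R j (insert i \<tau>) \<otimes> (x j \<otimes> f (insert j (insert i \<tau>))))))"
      using \<tau> x unfolding koszul_diff_def
      by (auto intro!: finsum_cong' finsum_closed m_closed simp: faces_insert fcl xcl)
    also have "\<dots> = (\<Oplus>i\<in>?A. \<Oplus>j\<in>?A. g i j)"
    proof (rule finsum_cong'[OF refl])
      fix i assume i: "i \<in> ?A"
      let ?t = "\<lambda>j. koszul_sgn R j (insert i \<tau>) \<otimes> (x j \<otimes> f (insert j (insert i \<tau>)))"
      have tcl: "?t j \<in> carrier R" if "j \<in> ?A - {i}" for j
        using that i fcl[of i j] xcl by auto
      have eq: "{1..n} - insert i \<tau> = ?A - {i}" by auto
      have "koszul_sgn R i \<tau> \<otimes> (x i \<otimes> (\<Oplus>j\<in>?A - {i}. ?t j))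
          = (\<Oplus>j\<in>?A - {i}. (koszul_sgn R i \<tau> \<otimes> x i) \<otimes> ?t j)"
        using tcl xcl[OF i] by (subst finsum_rdistr[symmetric]) (auto simp: m_assoc)
      also have "\<dots> = (\<Oplus>j\<in>?A - {i}. g i j)"
        using i fcl[of i] xcl by (intro finsum_cong'[OF refl]) (auto simp: g_def c_def m_ac)
      also have "\<dots> = (\<Oplus>j\<in>?A. g i j)"
        using i ccl by (intro add.finprod_mono_neutral_cong_left) (auto simp: g_def)
      finally show "koszul_sgn R i \<tau> \<otimes> (x i \<otimes> (\<Oplus>j\<in>{1..n} - insert i \<tau>. ?t j)) = (\<Oplus>j\<in>?A. g i j)"
        by (simp only: eq)
    qed (use ccl in \<open>auto simp: g_def intro!: finsum_closed\<close>)
    also have "\<dots> = \<zero>"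
    proof (rule finsum_antisym)
      fix i j assume ij: "i \<in> ?A" "j \<in> ?A" "i \<noteq> j"
      then show "g i j = \<ominus> g j i"
        using fcl[of i j] xcl koszul_sgn_swap[OF fin, of i j]
        by (simp add: g_def c_def insert_commute[of i j] m_comm[of "x i" "x j"] l_minus)
    qed (use ccl in \<open>auto simp: g_def\<close>)
    finally show ?thesis using \<tau> by simp
  qed (simp add: koszul_diff_def)
qed


lemma koszul_wedge_closed:
  "f \<in> faces n p \<rightarrow>\<^sub>E carrier R \<Longrightarrow> koszul_wedge R n p i f \<in> faces n (Suc p) \<rightarrow>\<^sub>E carrier R"
  using faces_remove[of i _ n p] by (fastforce simp: koszul_wedge_def intro!: m_closed)

lemma koszul_elem_wedge:
  assumes "\<sigma> \<in> faces n (Suc p)" "a \<in> carrier R"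
  shows "koszul_elem R n (Suc p) a \<sigma> =
    koszul_wedge R n p (Min \<sigma>) (koszul_elem R n p a (\<sigma> - {Min \<sigma>}))"
proof -
  have \<sigma>: "finite \<sigma>" "\<sigma> \<noteq> {}"
    using assms by (auto simp: faces_def finite_subset[OF _ finite_atLeastAtMost])
  have "{j \<in> \<sigma> - {Min \<sigma>}. j < Min \<sigma>} = {}"
    using \<sigma> by (auto simp: not_less)
  then have "koszul_sgn R (Min \<sigma>) (\<sigma> - {Min \<sigma>}) = \<one>"
    by (simp only: koszul_sgn_def) simp
  moreover have "\<tau> - {Min \<sigma>} \<in> faces n p" if "Min \<sigma> \<in> \<tau>" "\<tau> \<in> faces n (Suc p)" for \<tau>
    using that by (rule faces_remove)
  moreover have "\<tau> = \<sigma>" if "Min \<sigma> \<in> \<tau>" "\<tau> - {Min \<sigma>} = \<sigma> - {Min \<sigma>}" for \<tau>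
    using that Min_in[OF \<sigma>] by blast
  ultimately show ?thesis
    using assms Min_in[OF \<sigma>] by (auto simp: koszul_elem_def koszul_wedge_def fun_eq_iff)
qed

lemma koszul_diff_wedge_0:
  assumes x: "x \<in> {1..n} \<rightarrow> carrier R" and f: "f \<in> faces n 0 \<rightarrow>\<^sub>E carrier R" and i: "i \<in> {1..n}"
  shows "koszul_diff R x n 0 (koszul_wedge R n 0 i f) = x i \<odot>\<^bsub>koszul_module R n 0\<^esub> f"
proof -
  have [simp]: "faces n 0 = {{}}"
    by (auto simp: faces_def finite_subset[OF _ finite_atLeastAtMost])
  have [simp]: "faces n (Suc 0) = (\<lambda>j. {j}) ` {1..n}"
    by (auto simp: faces_def card_Suc_eq)
  have [simp]: "koszul_sgn R j {} = \<one>" for j by (simp add: koszul_sgn_def)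
  have f0 [simp]: "f {} \<in> carrier R" using f by auto
  have xcl [simp]: "x j \<in> carrier R" if "j \<in> {1..n}" for j using x that by auto
  have "(\<Oplus>j\<in>{1..n}. x j \<otimes> (if i = j then f {} else \<zero>))
      = (\<Oplus>j\<in>{1..n}. if i = j then x j \<otimes> f {} else \<zero>)"
    by (intro finsum_cong') auto
  also have "\<dots> = x i \<otimes> f {}"
    using i by (intro add.finprod_singleton) auto
  finally have "(\<Oplus>j\<in>{1..n}. x j \<otimes> (if i = j then f {} else \<zero>)) = x i \<otimes> f {}" .
  moreover have "(\<Oplus>j\<in>{1..n}. koszul_sgn R j {} \<otimes> (x j \<otimes> koszul_wedge R n 0 i f {j}))
      = (\<Oplus>j\<in>{1..n}. x j \<otimes> (if i = j then f {} else \<zero>))"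
  proof (rule finsum_cong'[OF refl])
    fix j assume "j \<in> {1..n}"
    then show "koszul_sgn R j {} \<otimes> (x j \<otimes> koszul_wedge R n 0 i f {j}) = x j \<otimes> (if i = j then f {} else \<zero>)"
      using xcl[of j] by (auto simp: koszul_wedge_def)
  qed auto
  ultimately have *: "(\<Oplus>j\<in>{1..n}. koszul_sgn R j {} \<otimes> (x j \<otimes> koszul_wedge R n 0 i f {j})) = x i \<otimes> f {}"
    by (rule trans[rotated])
  have "koszul_diff R x n 0 (koszul_wedge R n 0 i f) \<tau> = (x i \<odot>\<^bsub>koszul_module R n 0\<^esub> f) \<tau>" for \<tau>
    using * by (cases "\<tau> = {}") (simp_all add: koszul_diff_def)
  then show ?thesis ..
qed

lemma koszul_diff_wedge:
  assumes x: "x \<in> {1..n} \<rightarrow> carrier R" and f: "f \<in> faces n (Suc p) \<rightarrow>\<^sub>E carrier R"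
    and i: "i \<in> {1..n}"
  shows "koszul_diff R x n (Suc p) (koszul_wedge R n (Suc p) i f) =
    (x i \<odot>\<^bsub>koszul_module R n (Suc p)\<^esub> f)
      \<ominus>\<^bsub>koszul_module R n (Suc p)\<^esub> koszul_wedge R n p i (koszul_diff R x n p f)"
proof -
  interpret K: Module.module R "koszul_module R n (Suc p)" by (rule koszul_module_module)
  let ?L = "koszul_diff R x n (Suc p) (koszul_wedge R n (Suc p) i f)"
  let ?W = "koszul_wedge R n p i (koszul_diff R x n p f)"
  have W: "?W \<in> faces n (Suc p) \<rightarrow>\<^sub>E carrier R"
    by (intro koszul_wedge_closed koszul_diff_closed x f)
  have L: "?L \<in> faces n (Suc p) \<rightarrow>\<^sub>E carrier R"
    by (intro koszul_wedge_closed koszul_diff_closed x f)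
  have "?L \<oplus>\<^bsub>koszul_module R n (Suc p)\<^esub> ?W = x i \<odot>\<^bsub>koszul_module R n (Suc p)\<^esub> f"
  proof
    fix \<tau>
    show "(?L \<oplus>\<^bsub>koszul_module R n (Suc p)\<^esub> ?W) \<tau> = (x i \<odot>\<^bsub>koszul_module R n (Suc p)\<^esub> f) \<tau>"
    proof (cases "\<tau> \<in> faces n (Suc p)")
      case \<tau>: True
      then have fin: "finite \<tau>"
        by (auto simp: faces_def finite_subset[OF _ finite_atLeastAtMost])
      have xcl [simp]: "x j \<in> carrier R" if "j \<in> {1..n}" for j using x that by auto
      have f\<tau> [simp]: "f \<tau> \<in> carrier R" using f \<tau> by auto
      have L\<tau>: "?L \<tau> = (\<Oplus>j\<in>{1..n} - \<tau>. koszul_sgn R j \<tau> \<otimes> (x j \<otimes>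
          (if i \<in> insert j \<tau> then koszul_sgn R i (insert j \<tau> - {i}) \<otimes> f (insert j \<tau> - {i}) else \<zero>)))"
        (is "_ = (\<Oplus>j\<in>_. ?l j)")
      proof -
        have fcl: "f (insert j \<tau> - {i}) \<in> carrier R" if "j \<in> {1..n} - \<tau>" "i \<in> insert j \<tau>" for j
          using f faces_remove[OF that(2) faces_insert[OF that(1) \<tau>]] by auto
        have "?L \<tau> = (\<Oplus>j\<in>{1..n} - \<tau>. koszul_sgn R j \<tau> \<otimes> (x j \<otimes> koszul_wedge R n (Suc p) i f (insert j \<tau>)))"
          using \<tau> by (simp add: koszul_diff_def)
        also have "\<dots> = (\<Oplus>j\<in>{1..n} - \<tau>. ?l j)"
        proof (rule finsum_cong'[OF refl])
          show "?l \<in> {1..n} - \<tau> \<rightarrow> carrier R"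
            using fcl by (auto simp del: insert_iff)
        qed (use faces_insert[OF _ \<tau>] in \<open>simp add: koszul_wedge_def\<close>)
        finally show ?thesis .
      qed
      show ?thesis
      proof (cases "i \<in> \<tau>")
        case False
        have "(\<Oplus>j\<in>{1..n} - \<tau>. ?l j) = (\<Oplus>j\<in>{i}. x j \<otimes> f \<tau>)"
        proof (rule add.finprod_mono_neutral_cong_right)
          show "?l j = x j \<otimes> f \<tau>" if "j \<in> {i}" for j
          proof -
            have "?l i = (koszul_sgn R i \<tau> \<otimes> koszul_sgn R i \<tau>) \<otimes> (x i \<otimes> f \<tau>)"
              using False i by (simp add: m_ac)
            then show ?thesis using that i by (simp add: koszul_sgn_square)
          qed
        qed (use i False in auto)
        moreover have "?W \<tau> = \<zero>"
          using \<tau> False by (simp add: koszul_wedge_def)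
        ultimately show ?thesis using \<tau> i L\<tau> by simp
      next
        case True
        let ?s = "\<tau> - {i}"
        have s: "?s \<in> faces n p" using True \<tau> by (rule faces_remove)
        define t where "t j = koszul_sgn R i ?s \<otimes>
          (koszul_sgn R j ?s \<otimes> (x j \<otimes> f (insert j ?s)))" for j
        have fcl [simp]: "f (insert j ?s) \<in> carrier R" if "j \<in> {1..n} - ?s" for j
          using f faces_insert[OF that s] by auto
        have tcl: "t j \<in> carrier R" if "j \<in> {1..n} - ?s" for j
          using that fcl[OF that] xcl[of j] unfolding t_def by (auto simp del: fcl xcl)
        have "?W \<tau> = koszul_sgn R i ?s \<otimes> (\<Oplus>j\<in>{1..n} - ?s. koszul_sgn R j ?s \<otimes> (x j \<otimes> f (insert j ?s)))"
          using \<tau> True s by (simp add: koszul_wedge_def koszul_diff_def)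
        also have "\<dots> = (\<Oplus>j\<in>{1..n} - ?s. t j)"
          unfolding t_def by (rule finsum_rdistr) (auto intro!: m_closed fcl xcl)
        also have "{1..n} - ?s = insert i ({1..n} - \<tau>)"
          using True i by auto
        also have "(\<Oplus>j\<in>insert i ({1..n} - \<tau>). t j) = t i \<oplus> (\<Oplus>j\<in>{1..n} - \<tau>. t j)"
          using True i by (intro finsum_insert) (auto intro!: tcl)
        also have "t i = x i \<otimes> f \<tau>"
        proof -
          have "t i = (koszul_sgn R i ?s \<otimes> koszul_sgn R i ?s) \<otimes> (x i \<otimes> f \<tau>)"
            using True i by (simp add: t_def insert_absorb m_assoc)
          then show ?thesis using i by (simp add: koszul_sgn_square)
        qed
        finally have W\<tau>: "?W \<tau> = x i \<otimes> f \<tau> \<oplus> (\<Oplus>j\<in>{1..n} - \<tau>. t j)" .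
        have lt: "?l j = \<ominus> t j" if j: "j \<in> {1..n} - \<tau>" for j
        proof -
          have ij: "i \<noteq> j" "j \<notin> ?s" using j True by auto
          have eq: "insert j \<tau> - {i} = insert j ?s" "insert i ?s = \<tau>"
            using ij True by auto
          have fj: "f (insert j ?s) \<in> carrier R" "x j \<in> carrier R" using j fcl[of j] by auto
          have "?l j = (koszul_sgn R j \<tau> \<otimes> koszul_sgn R i (insert j ?s)) \<otimes> (x j \<otimes> f (insert j ?s))"
            using True fj by (simp add: eq m_ac)
          also have "koszul_sgn R j \<tau> \<otimes> koszul_sgn R i (insert j ?s) =
              \<ominus> (koszul_sgn R i ?s \<otimes> koszul_sgn R j ?s)"
          proof -
            have "koszul_sgn R j \<tau> = (if i < j then \<ominus> koszul_sgn R j ?s else koszul_sgn R j ?s)"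
              using koszul_sgn_insert[of ?s i j] fin unfolding eq(2) by simp
            moreover have "koszul_sgn R i (insert j ?s)
                = (if j < i then \<ominus> koszul_sgn R i ?s else koszul_sgn R i ?s)"
              using fin ij by (intro koszul_sgn_insert) auto
            ultimately show ?thesis
              using ij(1) by (cases i j rule: linorder_cases)
                (simp_all add: l_minus r_minus m_comm[of "koszul_sgn R i _"])
          qed
          finally show ?thesis using fj by (simp add: t_def l_minus m_assoc)
        qed
        have "?L \<tau> \<oplus> (\<Oplus>j\<in>{1..n} - \<tau>. t j) = (\<Oplus>j\<in>{1..n} - \<tau>. \<ominus> t j \<oplus> t j)"
        proof -
          have "?L \<tau> = (\<Oplus>j\<in>{1..n} - \<tau>. \<ominus> t j)"
            unfolding L\<tau> using lt tcl by (intro finsum_cong') auto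
          then show ?thesis using tcl by (simp add: finsum_addf Pi_def)
        qed
        also have "\<dots> = (\<Oplus>j\<in>{1..n} - \<tau>. \<zero>)"
          using tcl by (intro finsum_cong') (auto simp: l_neg)
        finally have *: "?L \<tau> \<oplus> (\<Oplus>j\<in>{1..n} - \<tau>. t j) = \<zero>" by simp
        have scl: "(\<Oplus>j\<in>{1..n} - \<tau>. t j) \<in> carrier R"
          using tcl by (intro finsum_closed) auto
        have Lcl: "?L \<tau> \<in> carrier R" using L \<tau> by auto
        have "?L \<tau> \<oplus> ?W \<tau> = x i \<otimes> f \<tau> \<oplus> (?L \<tau> \<oplus> (\<Oplus>j\<in>{1..n} - \<tau>. t j))"
          unfolding W\<tau> using scl Lcl i by (simp add: a_ac)
        then show ?thesis using * \<tau> i by simp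
      qed
    qed simp
  qed
  then have "(x i \<odot>\<^bsub>koszul_module R n (Suc p)\<^esub> f) \<ominus>\<^bsub>koszul_module R n (Suc p)\<^esub> ?W
      = (?L \<oplus>\<^bsub>koszul_module R n (Suc p)\<^esub> ?W) \<ominus>\<^bsub>koszul_module R n (Suc p)\<^esub> ?W"
    by (simp only:)
  also have "\<dots> = ?L"
  proof -
    have cl: "?L \<in> carrier (koszul_module R n (Suc p))" "?W \<in> carrier (koszul_module R n (Suc p))"
      using L W by simp_all
    show ?thesis
      by (simp only: K.M.minus_eq K.M.a_assoc[OF cl K.M.a_inv_closed[OF cl(2)]] K.M.r_neg[OF cl(2)] K.M.r_zero[OF cl(1)])
  qed
  finally show ?thesis ..
qed

end


context cring
begin

lemma koszul_diff_add:
  assumes x: "x \<in> {1..n} \<rightarrow> carrier R"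
    and f: "f \<in> faces n (Suc p) \<rightarrow>\<^sub>E carrier R" and g: "g \<in> faces n (Suc p) \<rightarrow>\<^sub>E carrier R"
  shows "koszul_diff R x n p (f \<oplus>\<^bsub>koszul_module R n (Suc p)\<^esub> g) =
    koszul_diff R x n p f \<oplus>\<^bsub>koszul_module R n p\<^esub> koszul_diff R x n p g"
proof
  fix \<tau>
  show "koszul_diff R x n p (f \<oplus>\<^bsub>koszul_module R n (Suc p)\<^esub> g) \<tau> =
    (koszul_diff R x n p f \<oplus>\<^bsub>koszul_module R n p\<^esub> koszul_diff R x n p g) \<tau>"
  proof (cases "\<tau> \<in> faces n p")
    case True
    have cl: "f (insert i \<tau>) \<in> carrier R" "g (insert i \<tau>) \<in> carrier R" "x i \<in> carrier R"
      if "i \<in> {1..n} - \<tau>" for i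
      using f g x faces_insert[OF that True] that by auto
    have "(\<Oplus>i\<in>{1..n} - \<tau>. koszul_sgn R i \<tau> \<otimes> (x i \<otimes> (f \<oplus>\<^bsub>koszul_module R n (Suc p)\<^esub> g) (insert i \<tau>)))
      = (\<Oplus>i\<in>{1..n} - \<tau>. koszul_sgn R i \<tau> \<otimes> (x i \<otimes> f (insert i \<tau>)) \<oplus>
          koszul_sgn R i \<tau> \<otimes> (x i \<otimes> g (insert i \<tau>)))"
    proof (rule finsum_cong'[OF refl])
      fix i assume i: "i \<in> {1..n} - \<tau>"
      show "koszul_sgn R i \<tau> \<otimes> (x i \<otimes> (f \<oplus>\<^bsub>koszul_module R n (Suc p)\<^esub> g) (insert i \<tau>))
        = koszul_sgn R i \<tau> \<otimes> (x i \<otimes> f (insert i \<tau>)) \<oplus> koszul_sgn R i \<tau> \<otimes> (x i \<otimes> g (insert i \<tau>))"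
        using cl[OF i] faces_insert[OF i True] by (simp add: r_distr)
    qed (use cl in auto)
    also have "\<dots> = (\<Oplus>i\<in>{1..n} - \<tau>. koszul_sgn R i \<tau> \<otimes> (x i \<otimes> f (insert i \<tau>))) \<oplus>
        (\<Oplus>i\<in>{1..n} - \<tau>. koszul_sgn R i \<tau> \<otimes> (x i \<otimes> g (insert i \<tau>)))"
      by (rule finsum_addf) (use cl in auto)
    finally show ?thesis using True by (simp add: koszul_diff_def del: koszul_module_simps(2)) simp
  qed (simp add: koszul_diff_def)
qed

lemma koszul_diff_smult:
  assumes x: "x \<in> {1..n} \<rightarrow> carrier R"
    and f: "f \<in> faces n (Suc p) \<rightarrow>\<^sub>E carrier R" and r: "r \<in> carrier R"
  shows "koszul_diff R x n p (r \<odot>\<^bsub>koszul_module R n (Suc p)\<^esub> f) =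
    r \<odot>\<^bsub>koszul_module R n p\<^esub> koszul_diff R x n p f"
proof
  fix \<tau>
  show "koszul_diff R x n p (r \<odot>\<^bsub>koszul_module R n (Suc p)\<^esub> f) \<tau> =
    (r \<odot>\<^bsub>koszul_module R n p\<^esub> koszul_diff R x n p f) \<tau>"
  proof (cases "\<tau> \<in> faces n p")
    case True
    have cl: "f (insert i \<tau>) \<in> carrier R" "x i \<in> carrier R" if "i \<in> {1..n} - \<tau>" for i
      using f x faces_insert[OF that True] that by auto
    have "(\<Oplus>i\<in>{1..n} - \<tau>. koszul_sgn R i \<tau> \<otimes> (x i \<otimes> (r \<odot>\<^bsub>koszul_module R n (Suc p)\<^esub> f) (insert i \<tau>)))
      = (\<Oplus>i\<in>{1..n} - \<tau>. r \<otimes> (koszul_sgn R i \<tau> \<otimes> (x i \<otimes> f (insert i \<tau>))))"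
    proof (rule finsum_cong'[OF refl])
      fix i assume i: "i \<in> {1..n} - \<tau>"
      show "koszul_sgn R i \<tau> \<otimes> (x i \<otimes> (r \<odot>\<^bsub>koszul_module R n (Suc p)\<^esub> f) (insert i \<tau>))
        = r \<otimes> (koszul_sgn R i \<tau> \<otimes> (x i \<otimes> f (insert i \<tau>)))"
        using cl[OF i] r faces_insert[OF i True] by (simp add: m_ac)
    qed (use cl r in auto)
    also have "\<dots> = r \<otimes> (\<Oplus>i\<in>{1..n} - \<tau>. koszul_sgn R i \<tau> \<otimes> (x i \<otimes> f (insert i \<tau>)))"
      by (rule finsum_rdistr[symmetric]) (use cl r in auto)
    finally show ?thesis using True by (simp add: koszul_diff_def del: koszul_module_simps(4)) simp
  qed (simp add: koszul_diff_def)
qed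

lemma koszul_cycles_submodule:
  assumes x: "x \<in> {1..n} \<rightarrow> carrier R"
  shows "Module.submodule (koszul_cycles R x n p) R (koszul_module R n p)"
proof -
  interpret K: Module.module R "koszul_module R n p" by (rule koszul_module_module)
  have q: "Module.module R (koszul_module R n q)" for q by (rule koszul_module_module)
  interpret K': Module.module R "koszul_module R n q" for q by (rule koszul_module_module)
  have add: "f \<oplus>\<^bsub>koszul_module R n p\<^esub> g \<in> koszul_cycles R x n p"
    if f: "f \<in> koszul_cycles R x n p" and g: "g \<in> koszul_cycles R x n p" for f g
  proof -
    have "koszul_diff R x n q (f \<oplus>\<^bsub>koszul_module R n p\<^esub> g) = \<zero>\<^bsub>koszul_module R n q\<^esub>"
      if "p = Suc q" for q
      using f g koszul_diff_add[OF x, of f q g] K'.M.r_zero[OF K'.M.zero_closed, of q] that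
      by (simp add: koszul_cycles_def del: koszul_module_simps(2,3))
    moreover have "f \<oplus>\<^bsub>koszul_module R n p\<^esub> g \<in> carrier (koszul_module R n p)"
      using f g by (intro K.M.a_closed) (auto simp: koszul_cycles_def)
    ultimately show ?thesis by (simp add: koszul_cycles_def del: koszul_module_simps)
  qed
  have smult: "r \<odot>\<^bsub>koszul_module R n p\<^esub> f \<in> koszul_cycles R x n p"
    if f: "f \<in> koszul_cycles R x n p" and r: "r \<in> carrier R" for f r
  proof -
    have "koszul_diff R x n q (r \<odot>\<^bsub>koszul_module R n p\<^esub> f) = \<zero>\<^bsub>koszul_module R n q\<^esub>"
      if "p = Suc q" for q
      using f r koszul_diff_smult[OF x, of f q r] K'.rmult_0[OF r, of q] that
      by (simp add: koszul_cycles_def del: koszul_module_simps(3,4))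
    moreover have "r \<odot>\<^bsub>koszul_module R n p\<^esub> f \<in> carrier (koszul_module R n p)"
      using f r by (intro K.smult_closed) (auto simp: koszul_cycles_def)
    ultimately show ?thesis by (simp add: koszul_cycles_def del: koszul_module_simps)
  qed
  have zero: "\<zero>\<^bsub>koszul_module R n p\<^esub> \<in> koszul_cycles R x n p"
  proof -
    have "koszul_diff R x n q \<zero>\<^bsub>koszul_module R n p\<^esub> = \<zero>\<^bsub>koszul_module R n q\<^esub>" if p: "p = Suc q" for q
    proof -
      have "koszul_diff R x n q (\<zero> \<odot>\<^bsub>koszul_module R n p\<^esub> \<zero>\<^bsub>koszul_module R n p\<^esub>)
          = \<zero> \<odot>\<^bsub>koszul_module R n q\<^esub> koszul_diff R x n q \<zero>\<^bsub>koszul_module R n p\<^esub>"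
        unfolding p by (rule koszul_diff_smult[OF x]) (use K'.M.zero_closed[of "Suc q"] in auto)
      moreover have "koszul_diff R x n q \<zero>\<^bsub>koszul_module R n p\<^esub> \<in> carrier (koszul_module R n q)"
        using koszul_diff_closed[OF x, of _ q] K'.M.zero_closed[of p] unfolding p
        by (simp del: koszul_module_simps(3))
      ultimately show ?thesis
        using K'.lmult_0 K.rmult_0[OF zero_closed] by metis
    qed
    then show ?thesis
      using K.M.zero_closed by (simp add: koszul_cycles_def del: koszul_module_simps)
  qed
  show ?thesis
  proof (rule K.submoduleI)
    show "koszul_cycles R x n p \<subseteq> carrier (koszul_module R n p)"
      by (auto simp: koszul_cycles_def)
    then show "\<ominus>\<^bsub>koszul_module R n p\<^esub> f \<in> koszul_cycles R x n p" if "f \<in> koszul_cycles R x n p" for f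
      using smult[OF that, of "\<ominus> \<one>"] K.smult_minus_1[of f] that by auto
  qed (use add smult zero in auto)
qed

lemma koszul_boundaries_submodule:
  assumes x: "x \<in> {1..n} \<rightarrow> carrier R"
  shows "Module.submodule (koszul_boundaries R x n p) R (koszul_cycle_module R x n p)"
proof -
  interpret K: Module.module R "koszul_module R n q" for q by (rule koszul_module_module)
  interpret Z: Module.module R "koszul_cycle_module R x n p"
    unfolding koszul_cycle_module_def
    by (rule submodule.submodule_is_module[OF koszul_cycles_submodule[OF x] koszul_module_module])
  have ops: "f \<oplus>\<^bsub>koszul_cycle_module R x n p\<^esub> g = f \<oplus>\<^bsub>koszul_module R n p\<^esub> g"
    "r \<odot>\<^bsub>koszul_cycle_module R x n p\<^esub> f = r \<odot>\<^bsub>koszul_module R n p\<^esub> f"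
    "\<zero>\<^bsub>koszul_cycle_module R x n p\<^esub> = \<zero>\<^bsub>koszul_module R n p\<^esub>"
    "carrier (koszul_cycle_module R x n p) = koszul_cycles R x n p" for f g r
    by (simp_all add: koszul_cycle_module_def)
  have sub: "koszul_boundaries R x n p \<subseteq> koszul_cycles R x n p"
    using koszul_diff_closed[OF x] koszul_diff_diff[OF x]
    by (auto simp: koszul_boundaries_def koszul_cycles_def)
  have smult: "r \<odot>\<^bsub>koszul_module R n p\<^esub> f \<in> koszul_boundaries R x n p"
    if f: "f \<in> koszul_boundaries R x n p" and r: "r \<in> carrier R" for r f
  proof -
    obtain g where g: "g \<in> carrier (koszul_module R n (Suc p))" "f = koszul_diff R x n p g"
      using f by (auto simp: koszul_boundaries_def)
    have "r \<odot>\<^bsub>koszul_module R n p\<^esub> f = koszul_diff R x n p (r \<odot>\<^bsub>koszul_module R n (Suc p)\<^esub> g)"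
      using koszul_diff_smult[OF x _ r, of g p] g by simp
    then show ?thesis
      using K.smult_closed[OF r g(1)] unfolding koszul_boundaries_def by blast
  qed
  have add: "f \<oplus>\<^bsub>koszul_module R n p\<^esub> f' \<in> koszul_boundaries R x n p"
    if ff: "f \<in> koszul_boundaries R x n p" "f' \<in> koszul_boundaries R x n p" for f f'
  proof -
    obtain g where g: "g \<in> carrier (koszul_module R n (Suc p))" "f = koszul_diff R x n p g"
      using ff by (auto simp: koszul_boundaries_def)
    obtain g' where g': "g' \<in> carrier (koszul_module R n (Suc p))" "f' = koszul_diff R x n p g'"
      using ff by (auto simp: koszul_boundaries_def)
    have "f \<oplus>\<^bsub>koszul_module R n p\<^esub> f' = koszul_diff R x n p (g \<oplus>\<^bsub>koszul_module R n (Suc p)\<^esub> g')"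
      using koszul_diff_add[OF x, of g p g'] g g' by simp
    then show ?thesis
      using K.M.a_closed[OF g(1) g'(1)] unfolding koszul_boundaries_def by blast
  qed
  have ne: "koszul_diff R x n p \<zero>\<^bsub>koszul_module R n (Suc p)\<^esub> \<in> koszul_boundaries R x n p"
    unfolding koszul_boundaries_def using K.M.zero_closed by blast
  have cl: "f \<in> carrier (koszul_module R n p)" if "f \<in> koszul_boundaries R x n p" for f
    using that sub by (auto simp: koszul_cycles_def)
  show ?thesis
  proof (rule Z.submoduleI)
    show "\<zero>\<^bsub>koszul_cycle_module R x n p\<^esub> \<in> koszul_boundaries R x n p"
      using smult[OF ne zero_closed] K.lmult_0[OF cl[OF ne]] by (simp only: ops)
    show "\<ominus>\<^bsub>koszul_cycle_module R x n p\<^esub> f \<in> koszul_boundaries R x n p"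
      if "f \<in> koszul_boundaries R x n p" for f
      using smult[OF that, of "\<ominus> \<one>"] Z.smult_minus_1[of f] that sub by (auto simp: ops)
  qed (use sub add smult in \<open>auto simp: ops simp del: koszul_module_simps\<close>)
qed

lemma koszul_homology_module:
  assumes x: "x \<in> {1..n} \<rightarrow> carrier R"
  shows "Module.module R (koszul_homology R x n p)"
  unfolding koszul_homology_def koszul_cycle_module_def
  by (rule quot_module_module[OF submodule.submodule_is_module[OF koszul_cycles_submodule[OF x]
        koszul_module_module] koszul_boundaries_submodule[OF x, unfolded koszul_cycle_module_def]])

end


section \<open>Monomial bases in the Koszul homology of \<open>R = S/I\<close>\<close>

abbreviation quot_ring :: "nat \<Rightarrow> 'k::field mpoly set \<Rightarrow> 'k mpoly set ring" where
  "quot_ring n I \<equiv> poly_ring n Quot I"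

definition residue_mon :: "nat \<Rightarrow> 'k::field mpoly set \<Rightarrow> (nat \<Rightarrow>\<^sub>0 nat) \<Rightarrow> 'k mpoly set" where
  "residue_mon n I u = I +>\<^bsub>poly_ring n\<^esub> xpow u"

abbreviation residue_var :: "nat \<Rightarrow> 'k::field mpoly set \<Rightarrow> nat \<Rightarrow> 'k mpoly set" where
  "residue_var n I i \<equiv> residue_mon n I (var i)"

definition residue_const :: "nat \<Rightarrow> 'k::field mpoly set \<Rightarrow> 'k \<Rightarrow> 'k mpoly set" where
  "residue_const n I c = I +>\<^bsub>poly_ring n\<^esub> Poly_Mapping.single 0 c"

definition homology ::
  "nat \<Rightarrow> 'k::field mpoly set \<Rightarrow> nat \<Rightarrow> ('k, (nat set \<Rightarrow> 'k mpoly set) set) module" where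
  "homology n I p =
    restrict_scalars (residue_const n I) (koszul_homology (quot_ring n I) (residue_var n I) n p)"

lemma vectorspace_homology:
  assumes I: "ideal I (poly_ring n :: 'k::field mpoly ring)"
  shows "vectorspace class_ring (homology n I p)"
proof -
  interpret S: cring "poly_ring n :: 'k mpoly ring" by (rule cring_poly_ring)
  interpret I: ideal I "poly_ring n" by (rule I)
  interpret R: cring "quot_ring n I" by (rule I.quotient_is_cring[OF S.is_cring])
  have hom: "(+>\<^bsub>poly_ring n\<^esub>) I \<in> Ring.ring_hom (poly_ring n) (quot_ring n I)"
    by (rule I.rcos_ring_hom)
  have x: "residue_var n I \<in> {1..n} \<rightarrow> carrier (quot_ring n I)"
    unfolding residue_mon_def
    by (auto intro!: ring_hom_closed[OF hom] xpow_in_poly_ring simp: monomials_def)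
  have "(\<lambda>c. Poly_Mapping.single 0 c :: 'k mpoly) \<in> Ring.ring_hom class_ring (poly_ring n)"
    by (rule ring_hom_memI) (auto simp: mult_single single_add)
  from ring_hom_trans[OF this hom]
  have "residue_const n I \<in> Ring.ring_hom class_ring (quot_ring n I)"
    by (simp add: residue_const_def[abs_def] o_def)
  then have "Module.module class_ring (homology n I p)"
    unfolding homology_def
    by (rule restrict_scalars_module[OF R.koszul_homology_module[OF x] class_cring.cring_axioms])
  then show ?thesis
    by (simp add: vectorspace_def class_field.field_axioms)
qed

definition monomial_cycles ::
  "nat \<Rightarrow> 'k::field mpoly set \<Rightarrow> nat \<Rightarrow> (nat set \<Rightarrow> 'k mpoly set) set" where
  "monomial_cycles n I p =
    {z \<in> koszul_cycles (quot_ring n I) (residue_var n I) n p.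
      \<exists>u\<in>monomials n. \<exists>\<sigma>\<in>faces n p. z = koszul_elem (quot_ring n I) n p (residue_mon n I u) \<sigma>}"

definition admits_monomial_basis :: "nat \<Rightarrow> 'k::field mpoly set \<Rightarrow> bool" where
  "admits_monomial_basis n I \<longleftrightarrow>
    (\<forall>p\<in>{1..n}.
      carrier (homology n I p) = {\<zero>\<^bsub>homology n I p\<^esub>} \<or>
      (\<exists>B. B \<subseteq> koszul_class (quot_ring n I) (residue_var n I) n p ` monomial_cycles n I p \<and>
        vectorspace.basis class_ring (homology n I p) B))"

end

theory Submission
  imports Defs
begin

text \<open>Chains over \<open>S\<close> are graded by the exponent vectors \<open>a\<close>, with \<open>w e\<^sub>\<sigma>\<close> in degree \<open>a = w + \<sigma>\<close>. In
  degree \<open>a \<noteq> 0\<close> choose an index \<open>j = m(a)\<close> in the support of \<open>a\<close> and let \<open>h\<close> be the map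
  \<open>f \<mapsto> x\<^sub>j\<^sup>-\<^sup>1 e\<^sub>j \<and> f\<close>; then \<open>f - \<partial>(h f) = x\<^sub>j\<^sup>-\<^sup>1 e\<^sub>j \<and> \<partial>f\<close>. If \<open>f\<close> is a cycle modulo \<open>I\<close>, every term
  \<open>w e\<^sub>\<sigma>\<close> of the right-hand side has \<open>j \<in> \<sigma>\<close> and \<open>x\<^sub>j w \<in> I\<close>. With \<open>j = max(a)\<close>, stability turns this
  into \<open>x\<^sub>i w \<in> I\<close> for all \<open>i \<in> \<sigma>\<close>, i.e. \<open>w e\<^sub>\<sigma>\<close> is a monomial cycle. In the squarefree case the same
  works for squarefree \<open>a\<close>; otherwise take \<open>j\<close> with \<open>a\<^sub>j \<ge> 2\<close>, where \<open>x\<^sub>j w \<in> I\<close> already gives \<open>w \<in> I\<close>.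
  So the classes of monomial cycles span the homology, and a maximal independent set of them is
  a basis.\<close>


section \<open>Linear algebra\<close>

text \<open>Zorn's lemma for the independent subsets of \<open>G\<close>; neither \<open>G\<close>
  nor the dimension is assumed finite. A dependence involves only finitely many vectors, so one in
  the union of a nonempty chain already occurs in a member of the chain. A maximal independent
  \<open>B\<close> spans, since adjoining any further vector of \<open>G\<close> creates a
  dependence.\<close>

lemma (in vectorspace) basis_in_gen_set:
  assumes G: "G \<subseteq> carrier V" "gen_set G"
  shows "\<exists>B\<subseteq>G. basis B"
proof -
  let ?A = "{B. B \<subseteq> G \<and> lin_indpt B}"
  have "\<exists>M\<in>?A. \<forall>X\<in>?A. M \<subseteq> X \<longrightarrow> X = M"
  proof (rule subset_Zorn', goal_cases)
    case (1 C)
    have "\<not> lin_dep (\<Union>C)"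
    proof
      assume "lin_dep (\<Union>C)"
      then obtain A a v where A: "finite A" "A \<subseteq> \<Union>C" "a \<in> A \<rightarrow> carrier K"
          "lincomb a A = \<zero>\<^bsub>V\<^esub>" "v \<in> A" "a v \<noteq> \<zero>\<^bsub>K\<^esub>"
        by (auto simp: lin_dep_def)
      then have "C \<noteq> {}" by auto
      then obtain X where X: "X \<in> C" "A \<subseteq> X"
        using finite_subset_Union_chain[OF A(1,2) _ 1] by blast
      then have "lin_dep X" using A by (auto simp: lin_dep_def)
      then show False using X 1 by (auto simp: subset_chain_def)
    qed
    then show ?case using 1 by (auto simp: subset_chain_def)
  qed
  then obtain B where "B \<in> ?A" and max: "\<And>X. X \<in> ?A \<Longrightarrow> B \<subseteq> X \<Longrightarrow> X = B"
    by meson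
  then have B: "B \<subseteq> G" "lin_indpt B" by simp_all
  have BV: "B \<subseteq> carrier V" using B(1) G(1) by (rule subset_trans)
  have "v \<in> span B" if v: "v \<in> G" for v
  proof (cases "v \<in> B")
    case True
    then show ?thesis using in_own_span[OF BV] by (rule rev_subsetD)
  next
    case False
    have "lin_dep (B \<union> {v})"
    proof (rule ccontr)
      assume "lin_indpt (B \<union> {v})"
      then have "B \<union> {v} = B" using v B(1) by (intro max) auto
      then show False using False by auto
    qed
    moreover have "v \<in> carrier V" using v G(1) by (rule rev_subsetD)
    ultimately show ?thesis using lin_dep_iff_in_span[OF BV B(2) _ False] by simp
  qed
  then have "span G \<subseteq> span B"
    using span_is_submodule[OF BV] by (intro span_is_subset) auto
  then have "gen_set B" using G(2) span_is_subset2[OF BV] by (intro equalityI) simp_all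
  then show ?thesis using B BV unfolding basis_def by auto
qed

section \<open>Computing in quotient modules through representatives\<close>

text \<open>Scalar multiplication in \<open>quot_module\<close> is a union over all representatives
  of a coset. These rules reduce it, and the other operations, to a single representative, which is
  the form in which homology classes are handled below.\<close>

lemma
  assumes M: "Module.module R M" and N: "Module.submodule N R M"
  shows carrier_quot_module: "carrier (quot_module M N) = (\<lambda>x. N +>\<^bsub>M\<^esub> x) ` carrier M"
    and quot_module_zero: "\<zero>\<^bsub>quot_module M N\<^esub> = N +>\<^bsub>M\<^esub> \<zero>\<^bsub>M\<^esub>"
    and quot_module_add: "\<And>x y. x \<in> carrier M \<Longrightarrow> y \<in> carrier M \<Longrightarrow>
      (N +>\<^bsub>M\<^esub> x) \<oplus>\<^bsub>quot_module M N\<^esub> (N +>\<^bsub>M\<^esub> y) = N +>\<^bsub>M\<^esub> (x \<oplus>\<^bsub>M\<^esub> y)"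
    and quot_module_smult: "\<And>r x. r \<in> carrier R \<Longrightarrow> x \<in> carrier M \<Longrightarrow>
      r \<odot>\<^bsub>quot_module M N\<^esub> (N +>\<^bsub>M\<^esub> x) = N +>\<^bsub>M\<^esub> (r \<odot>\<^bsub>M\<^esub> x)"
    and quot_module_absorb: "\<And>x y. x \<in> carrier M \<Longrightarrow> y \<in> N \<Longrightarrow> N +>\<^bsub>M\<^esub> (x \<oplus>\<^bsub>M\<^esub> y) = N +>\<^bsub>M\<^esub> x"
proof -
  interpret Module.module R M by (rule M)
  interpret N: Module.submodule N R M by (rule N)
  interpret N: abelian_subgroup N M
    by (intro abelian_subgroupI3 additive_subgroup.intro N.subgroup_axioms abelian_group_axioms)
  show "carrier (quot_module M N) = (\<lambda>x. N +>\<^bsub>M\<^esub> x) ` carrier M"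
    by (auto simp: quot_module_def A_RCOSETS_def' a_r_coset_def')
  show "\<zero>\<^bsub>quot_module M N\<^esub> = N +>\<^bsub>M\<^esub> \<zero>\<^bsub>M\<^esub>"
    by (simp add: quot_module_def N.a_subset)
  show add: "(N +>\<^bsub>M\<^esub> x) \<oplus>\<^bsub>quot_module M N\<^esub> (N +>\<^bsub>M\<^esub> y) = N +>\<^bsub>M\<^esub> (x \<oplus>\<^bsub>M\<^esub> y)"
    if "x \<in> carrier M" "y \<in> carrier M" for x y
    using that by (simp add: quot_module_def N.a_rcos_sum)
  show absorb: "N +>\<^bsub>M\<^esub> (x \<oplus>\<^bsub>M\<^esub> y) = N +>\<^bsub>M\<^esub> x" if x: "x \<in> carrier M" and y: "y \<in> N" for x y
  proof -
    have "x \<oplus>\<^bsub>M\<^esub> y = y \<oplus>\<^bsub>M\<^esub> x" using x y N.a_subset by (intro M.a_comm) auto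
    then have "x \<oplus>\<^bsub>M\<^esub> y \<in> N +>\<^bsub>M\<^esub> x" using y by (auto simp: a_r_coset_def r_coset_def)
    then show ?thesis using N.a_repr_independence' x by metis
  qed
  show "r \<odot>\<^bsub>quot_module M N\<^esub> (N +>\<^bsub>M\<^esub> x) = N +>\<^bsub>M\<^esub> (r \<odot>\<^bsub>M\<^esub> x)"
    if r: "r \<in> carrier R" and x: "x \<in> carrier M" for r x
  proof -
    have "N +>\<^bsub>M\<^esub> (r \<odot>\<^bsub>M\<^esub> y) = N +>\<^bsub>M\<^esub> (r \<odot>\<^bsub>M\<^esub> x)" if y: "y \<in> N +>\<^bsub>M\<^esub> x" for y
    proof -
      obtain h where h: "h \<in> N" "y = h \<oplus>\<^bsub>M\<^esub> x"
        using y by (auto simp: a_r_coset_def r_coset_def)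
      have hM: "h \<in> carrier M" using h N.a_subset by auto
      have "r \<odot>\<^bsub>M\<^esub> y = r \<odot>\<^bsub>M\<^esub> x \<oplus>\<^bsub>M\<^esub> r \<odot>\<^bsub>M\<^esub> h"
        using h hM r x by (simp add: smult_r_distr M.a_comm)
      then show ?thesis using absorb[of "r \<odot>\<^bsub>M\<^esub> x" "r \<odot>\<^bsub>M\<^esub> h"] h r x by simp
    qed
    moreover have "x \<in> N +>\<^bsub>M\<^esub> x" using x by (rule N.a_rcos_self)
    ultimately have "(\<Union>y\<in>N +>\<^bsub>M\<^esub> x. N +>\<^bsub>M\<^esub> (r \<odot>\<^bsub>M\<^esub> y)) = N +>\<^bsub>M\<^esub> (r \<odot>\<^bsub>M\<^esub> x)"
      by blast
    then show ?thesis by (simp add: quot_module_def)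
  qed
qed


section \<open>Koszul chains over the polynomial ring\<close>

text \<open>Multiplication by a monomial shifts exponents. The test that \<open>u\<close> divides
  \<open>w\<close> guards the subtraction of exponent vectors, which truncates at zero.\<close>

lemma lookup_single_mult:
  fixes f :: "(nat \<Rightarrow>\<^sub>0 nat) \<Rightarrow>\<^sub>0 'k::comm_semiring_1"
  shows "Poly_Mapping.lookup (Poly_Mapping.single u c * f) w =
    (if \<exists>v. w = u + v then c * Poly_Mapping.lookup f (w - u) else 0)"
proof -
  have "(\<Sum>q. Poly_Mapping.lookup f q when w = u + q) =
      (if \<exists>v. w = u + v then Poly_Mapping.lookup f (w - u) else 0)"
  proof (cases "\<exists>v. w = u + v")
    case True
    then obtain v where v: "w = u + v" by blast
    then have "(\<Sum>q. Poly_Mapping.lookup f q when w = u + q) =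
        (\<Sum>q. Poly_Mapping.lookup f q when q = v)"
      by (intro Sum_any.cong) (auto simp: when_def)
    then show ?thesis using v by simp
  next
    case False
    then show ?thesis by simp
  qed
  then show ?thesis
    by (simp add: lookup_mult lookup_single when_mult)
qed

lemma (in ring_hom_cring) hom_koszul_sgn: "h (koszul_sgn R i \<tau>) = koszul_sgn S i \<tau>"
proof -
  have "h ((\<ominus>\<^bsub>R\<^esub> \<one>\<^bsub>R\<^esub>) [^]\<^bsub>R\<^esub> k) = (\<ominus>\<^bsub>S\<^esub> \<one>\<^bsub>S\<^esub>) [^]\<^bsub>S\<^esub> k" for k :: nat
    by (induction k) simp_all
  then show ?thesis by (simp add: koszul_sgn_def)
qed

text \<open>Base change along a ring homomorphism is a chain map. Applied to the residue map from S
  to S/I, it lets chains over the quotient be studied through polynomial lifts.\<close>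

lemma (in ring_hom_cring) koszul_diff_hom:
  assumes x: "x \<in> {1..n} \<rightarrow> carrier R" and f: "f \<in> faces n (Suc p) \<rightarrow> carrier R"
  shows "koszul_diff S (\<lambda>i. h (x i)) n p (\<lambda>\<sigma>\<in>faces n (Suc p). h (f \<sigma>)) =
    (\<lambda>\<tau>\<in>faces n p. h (koszul_diff R x n p f \<tau>))"
proof
  fix \<tau>
  show "koszul_diff S (\<lambda>i. h (x i)) n p (\<lambda>\<sigma>\<in>faces n (Suc p). h (f \<sigma>)) \<tau> =
    (\<lambda>\<tau>\<in>faces n p. h (koszul_diff R x n p f \<tau>)) \<tau>"
  proof (cases "\<tau> \<in> faces n p")
    case True
    have cl: "x i \<in> carrier R" "f (insert i \<tau>) \<in> carrier R" "insert i \<tau> \<in> faces n (Suc p)"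
      if "i \<in> {1..n} - \<tau>" for i
      using that x f faces_insert[OF that True] by auto
    have "h (\<Oplus>\<^bsub>R\<^esub>i\<in>{1..n} - \<tau>. koszul_sgn R i \<tau> \<otimes>\<^bsub>R\<^esub> (x i \<otimes>\<^bsub>R\<^esub> f (insert i \<tau>)))
      = (\<Oplus>\<^bsub>S\<^esub>i\<in>{1..n} - \<tau>. (h \<circ> (\<lambda>i. koszul_sgn R i \<tau> \<otimes>\<^bsub>R\<^esub> (x i \<otimes>\<^bsub>R\<^esub> f (insert i \<tau>)))) i)"
      using cl by (subst hom_finsum) auto
    also have "\<dots> = (\<Oplus>\<^bsub>S\<^esub>i\<in>{1..n} - \<tau>. koszul_sgn S i \<tau> \<otimes>\<^bsub>S\<^esub>
        (h (x i) \<otimes>\<^bsub>S\<^esub> (\<lambda>\<sigma>\<in>faces n (Suc p). h (f \<sigma>)) (insert i \<tau>)))"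
      using cl by (intro S.finsum_cong') (auto simp: hom_koszul_sgn simp del: insert_iff)
    finally show ?thesis using True by (simp add: koszul_diff_def)
  qed (simp add: koszul_diff_def)
qed

lemma ring_hom_const:
  "(\<lambda>c. Poly_Mapping.single 0 c :: 'k::field mpoly) \<in> Ring.ring_hom class_ring (poly_ring n)"
  by (rule ring_hom_memI) (auto simp: mult_single single_add)

lemma poly_ring_finsum:
  "f \<in> A \<rightarrow> carrier (poly_ring n) \<Longrightarrow> (\<Oplus>\<^bsub>poly_ring n\<^esub>i\<in>A. f i) = (\<Sum>i\<in>A. f i :: 'k::field mpoly)"
proof -
  interpret S: cring "poly_ring n :: 'k mpoly ring" by (rule cring_poly_ring)
  show "f \<in> A \<rightarrow> carrier (poly_ring n) \<Longrightarrow> (\<Oplus>\<^bsub>poly_ring n\<^esub>i\<in>A. f i) = (\<Sum>i\<in>A. f i)"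
  proof (induction A rule: infinite_finite_induct)
    case (infinite A)
    then show ?case by (simp add: S.finsum_infinite)
  next
    case (insert a A)
    then have "(\<Oplus>\<^bsub>poly_ring n\<^esub>i\<in>insert a A. f i) = f a \<oplus>\<^bsub>poly_ring n\<^esub> (\<Oplus>\<^bsub>poly_ring n\<^esub>i\<in>A. f i)"
      by (intro S.finsum_insert) auto
    with insert show ?case by (simp add: Pi_def)
  qed simp
qed

section \<open>Coefficients of the Koszul differential over S\<close>

text \<open>The signs are read in the coefficient field, so that single coefficients of chains can
  be compared by field arithmetic.\<close>

abbreviation sgn_coeff :: "nat \<Rightarrow> nat set \<Rightarrow> 'k::field" where
  "sgn_coeff i \<tau> \<equiv> koszul_sgn class_ring i \<tau>"

abbreviation poly_diff :: "nat \<Rightarrow> nat \<Rightarrow> (nat set \<Rightarrow> 'k::field mpoly) \<Rightarrow> nat set \<Rightarrow> 'k mpoly" where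
  "poly_diff n \<equiv> koszul_diff (poly_ring n) (\<lambda>i. xpow (var i)) n"

lemma poly_ring_koszul_sgn:
  "koszul_sgn (poly_ring n) i \<tau> = Poly_Mapping.single 0 (sgn_coeff i \<tau> :: 'k::field)"
proof -
  interpret h: ring_hom_cring class_ring "poly_ring n" "\<lambda>c. Poly_Mapping.single 0 c :: 'k mpoly"
    by (simp add: ring_hom_cring_def ring_hom_cring_axioms_def class_cring.cring_axioms
        cring_poly_ring ring_hom_const)
  show ?thesis by (rule h.hom_koszul_sgn[symmetric])
qed

lemma var_in_monomials: "i \<in> {1..n} \<Longrightarrow> var i \<in> monomials n"
  by (simp add: monomials_def)

lemma ex_add_var_iff: "(\<exists>v. w = var i + v) \<longleftrightarrow> i \<in> Poly_Mapping.keys w"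
proof
  assume "i \<in> Poly_Mapping.keys w"
  then have "w = var i + (w - var i)"
    by (intro poly_mapping_eqI) (auto simp: lookup_add lookup_minus lookup_single when_def in_keys_iff)
  then show "\<exists>v. w = var i + v" ..
qed (auto simp: in_keys_iff lookup_add)

text \<open>The terms contributing to \<open>w e_\<tau>\<close> are those of the form (w/x_i)
  e_{\<tau> \<union> {i}}, which exist only for x_i dividing w; this is the role of the test
  \<open>i \<in> keys w\<close>.\<close>

lemma lookup_poly_diff:
  fixes f :: "nat set \<Rightarrow> 'k::field mpoly"
  assumes f: "f \<in> faces n (Suc p) \<rightarrow> carrier (poly_ring n)" and \<tau>: "\<tau> \<in> faces n p"
  shows "Poly_Mapping.lookup (poly_diff n p f \<tau>) w =
    (\<Sum>i\<in>{1..n} - \<tau>. sgn_coeff i \<tau> *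
      (if i \<in> Poly_Mapping.keys w then Poly_Mapping.lookup (f (insert i \<tau>)) (w - var i) else 0))"
proof -
  interpret S: cring "poly_ring n :: 'k mpoly ring" by (rule cring_poly_ring)
  have cl: "koszul_sgn (poly_ring n) i \<tau> \<otimes>\<^bsub>poly_ring n\<^esub> (xpow (var i) \<otimes>\<^bsub>poly_ring n\<^esub> f (insert i \<tau>))
      \<in> carrier (poly_ring n)" if "i \<in> {1..n} - \<tau>" for i
    using that f faces_insert[OF that \<tau>] xpow_in_poly_ring[OF var_in_monomials[of i n]]
    by (intro S.m_closed S.koszul_sgn_closed) auto
  have "poly_diff n p f \<tau> = (\<Sum>i\<in>{1..n} - \<tau>.
      koszul_sgn (poly_ring n) i \<tau> \<otimes>\<^bsub>poly_ring n\<^esub> (xpow (var i) \<otimes>\<^bsub>poly_ring n\<^esub> f (insert i \<tau>)))"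
    unfolding koszul_diff_def using \<tau> cl
    by (simp only: restrict_apply if_True) (intro poly_ring_finsum, blast)
  also have "\<dots> = (\<Sum>i\<in>{1..n} - \<tau>. Poly_Mapping.single 0 (sgn_coeff i \<tau>) * (xpow (var i) * f (insert i \<tau>)))"
    by (simp add: poly_ring_koszul_sgn)
  finally show ?thesis
    by (simp add: lookup_sum lookup_single_mult xpow_def ex_add_var_iff del: One_nat_def cong: if_cong)
qed

section \<open>Multidegrees and the contracting homotopy\<close>

text \<open>The multidegree of \<open>e_\<sigma>\<close>; the term \<open>w e_\<sigma>\<close> has
  multidegree \<open>w + face_mon \<sigma>\<close>.\<close>

definition face_mon :: "nat set \<Rightarrow> (nat \<Rightarrow>\<^sub>0 nat)" where
  "face_mon \<sigma> = (\<Sum>i\<in>\<sigma>. var i)"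

lemma keys_add_nat: "Poly_Mapping.keys (u + v :: nat \<Rightarrow>\<^sub>0 nat) = Poly_Mapping.keys u \<union> Poly_Mapping.keys v"
  by (auto simp: in_keys_iff lookup_add)

lemma lookup_face_mon: "finite \<sigma> \<Longrightarrow> Poly_Mapping.lookup (face_mon \<sigma>) i = (if i \<in> \<sigma> then 1 else 0)"
  by (simp add: face_mon_def lookup_sum lookup_single when_def)

lemma keys_face_mon: "finite \<sigma> \<Longrightarrow> Poly_Mapping.keys (face_mon \<sigma>) = \<sigma>"
  by (auto simp: in_keys_iff lookup_face_mon split: if_splits)

text \<open>Trading a factor x_i of the monomial for the index i in the face preserves the
  multidegree. Hence the differential is homogeneous, and a function \<open>m\<close> of the
  multidegree selects the same index on all terms that interact.\<close>

lemma diff_var_add_face_mon: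
  assumes "finite \<sigma>" "i \<notin> \<sigma>" "i \<in> Poly_Mapping.keys w"
  shows "w - var i + face_mon (insert i \<sigma>) = w + face_mon \<sigma>"
  using assms by (intro poly_mapping_eqI)
    (auto simp: lookup_add lookup_minus lookup_single lookup_face_mon when_def in_keys_iff)

text \<open>The map \<open>h\<close>: the coefficient of \<open>w e\<^sub>\<rho>\<close> in \<open>h f\<close> is, up to sign, that of
  \<open>x\<^sub>j w e\<^bsub>\<rho> - {j}\<^esub>\<close> in \<open>f\<close>, where \<open>j = m(w + \<rho>)\<close>.\<close>

definition contraction ::
  "((nat \<Rightarrow>\<^sub>0 nat) \<Rightarrow> nat) \<Rightarrow> nat \<Rightarrow> nat \<Rightarrow> (nat set \<Rightarrow> 'k::field mpoly) \<Rightarrow> nat set \<Rightarrow> 'k mpoly" where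
  "contraction m n p f = (\<lambda>\<rho>\<in>faces n (Suc p). Abs_poly_mapping (\<lambda>w.
     let j = m (w + face_mon \<rho>)
     in if j \<in> \<rho> then sgn_coeff j (\<rho> - {j}) * Poly_Mapping.lookup (f (\<rho> - {j})) (w + var j) else 0))"

lemma finite_faces: "\<sigma> \<in> faces n p \<Longrightarrow> finite \<sigma>"
  by (auto simp: faces_def finite_subset[OF _ finite_atLeastAtMost])

text \<open>The function under \<open>Abs_poly_mapping\<close> has finite support for any
  \<open>m\<close>: the chosen index runs through the finite set \<open>\<rho>\<close>, and for each
  j the admissible w come from dividing the finitely many monomials of f(\<rho> - {j}) by
  x_j.\<close>

lemma lookup_contraction:
  fixes f :: "nat set \<Rightarrow> 'k::field mpoly"
  assumes \<rho>: "\<rho> \<in> faces n (Suc p)"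
  shows "Poly_Mapping.lookup (contraction m n p f \<rho>) w = (let j = m (w + face_mon \<rho>)
     in if j \<in> \<rho> then sgn_coeff j (\<rho> - {j}) * Poly_Mapping.lookup (f (\<rho> - {j})) (w + var j) else 0)"
proof -
  let ?c = "\<lambda>w. let j = m (w + face_mon \<rho>)
     in if j \<in> \<rho> then sgn_coeff j (\<rho> - {j}) * Poly_Mapping.lookup (f (\<rho> - {j})) (w + var j) else 0"
  have "{w. ?c w \<noteq> 0} \<subseteq> (\<Union>j\<in>\<rho>. (\<lambda>v. v - var j) ` Poly_Mapping.keys (f (\<rho> - {j})))"
  proof
    fix w assume "w \<in> {w. ?c w \<noteq> 0}"
    then have "m (w + face_mon \<rho>) \<in> \<rho>"
      "w + var (m (w + face_mon \<rho>)) \<in> Poly_Mapping.keys (f (\<rho> - {m (w + face_mon \<rho>)}))"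
      by (auto simp: Let_def in_keys_iff split: if_splits)
    then show "w \<in> (\<Union>j\<in>\<rho>. (\<lambda>v. v - var j) ` Poly_Mapping.keys (f (\<rho> - {j})))"
      by (intro UN_I[of "m (w + face_mon \<rho>)"]) (auto intro!: image_eqI)
  qed
  then have "finite {w. ?c w \<noteq> 0}"
    by (rule finite_subset) (use finite_faces[OF \<rho>] in simp)
  then show ?thesis
    using \<rho> by (simp add: contraction_def)
qed

lemma contraction_closed:
  fixes f :: "nat set \<Rightarrow> 'k::field mpoly"
  assumes f: "f \<in> faces n p \<rightarrow> carrier (poly_ring n)"
  shows "contraction m n p f \<in> faces n (Suc p) \<rightarrow>\<^sub>E carrier (poly_ring n)"
proof
  fix \<rho> assume \<rho>: "\<rho> \<in> faces n (Suc p)"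
  have "w \<in> monomials n" if w: "w \<in> Poly_Mapping.keys (contraction m n p f \<rho>)" for w
  proof -
    let ?j = "m (w + face_mon \<rho>)"
    have j: "?j \<in> \<rho>" "w + var ?j \<in> Poly_Mapping.keys (f (\<rho> - {?j}))"
      using w by (auto simp: in_keys_iff lookup_contraction[OF \<rho>] Let_def split: if_splits)
    then have "w + var ?j \<in> monomials n"
      using f faces_remove[OF j(1) \<rho>] by auto
    then show ?thesis by (simp add: monomials_def keys_add_nat)
  qed
  then show "contraction m n p f \<rho> \<in> carrier (poly_ring n)" by auto
qed (simp add: contraction_def)

text \<open>This is the homotopy identity id - \<partial>h = h\<partial> on one coefficient: in a
  fixed multidegree, \<partial>(e_j \<and> f) = x_j f - e_j \<and> \<partial>f divided by x_j. Since
  \<open>j\<close> lies in the support of the multidegree, x_j divides the monomial of every term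
  whose face omits \<open>j\<close>, so the division is exact.\<close>

lemma lookup_diff_contraction:
  fixes f :: "nat set \<Rightarrow> 'k::field mpoly"
  assumes f: "f \<in> faces n (Suc p) \<rightarrow> carrier (poly_ring n)"
    and \<sigma>: "\<sigma> \<in> faces n (Suc p)" and w: "w \<in> monomials n"
    and j: "j = m (w + face_mon \<sigma>)" "j \<in> Poly_Mapping.keys (w + face_mon \<sigma>)"
  shows "Poly_Mapping.lookup (f \<sigma> - poly_diff n (Suc p) (contraction m n (Suc p) f) \<sigma>) w =
    (if j \<in> \<sigma> then sgn_coeff j (\<sigma> - {j}) * Poly_Mapping.lookup (poly_diff n p f (\<sigma> - {j})) (w + var j)
     else 0)"
proof -
  have fin: "finite \<sigma>" using \<sigma> by (rule finite_faces)
  have cl: "contraction m n (Suc p) f \<in> faces n (Suc (Suc p)) \<rightarrow> carrier (poly_ring n)"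
    using contraction_closed[OF f] by (auto simp: PiE_iff)
  \<comment> \<open>Every term involved has the multidegree of \<open>w e_\<sigma>\<close>, so
    \<open>m\<close> returns the same \<open>j\<close> for each \<open>i\<close>.\<close>
  have 1: "Poly_Mapping.lookup (poly_diff n (Suc p) (contraction m n (Suc p) f) \<sigma>) w =
    (\<Sum>i\<in>{1..n} - \<sigma>. sgn_coeff i \<sigma> * (if i \<in> Poly_Mapping.keys w \<and> j \<in> insert i \<sigma>
      then sgn_coeff j (insert i \<sigma> - {j}) *
        Poly_Mapping.lookup (f (insert i \<sigma> - {j})) (w - var i + var j)
      else 0))"
    unfolding lookup_poly_diff[OF cl \<sigma>]
  proof (intro sum.cong refl, goal_cases)
    case (1 i)
    then show ?case
      using diff_var_add_face_mon[OF fin, of i w] faces_insert[OF 1 \<sigma>]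
      by (simp add: lookup_contraction Let_def j(1) del: One_nat_def)
  qed
  have sq: "sgn_coeff i \<tau> * sgn_coeff i \<tau> = (1 :: 'k)" for i \<tau>
    using class_cring.koszul_sgn_square[of i \<tau>] by simp
  show ?thesis
  proof (cases "j \<in> \<sigma>")
    case False
    \<comment> \<open>\<open>j\<close> is in the multidegree but not in the face, so x_j divides w.
      Only i = j puts \<open>j\<close> into the enlarged face, and this summand returns the
      coefficient of f times the square of a sign. The difference therefore vanishes.\<close>
    then have j': "j \<in> {1..n} - \<sigma>" "j \<in> Poly_Mapping.keys w"
      using j(2) w fin by (auto simp: keys_add_nat keys_face_mon monomials_def)
    have "Poly_Mapping.lookup (poly_diff n (Suc p) (contraction m n (Suc p) f) \<sigma>) w =
      (\<Sum>i\<in>{1..n} - \<sigma>. if i = j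
        then sgn_coeff j \<sigma> * (sgn_coeff j \<sigma> * Poly_Mapping.lookup (f \<sigma>) w) else 0)"
      unfolding 1
    proof (intro sum.cong refl, goal_cases)
      case (1 i)
      have "w - var j + var j = w"
        using j'(2) by (intro poly_mapping_eqI)
          (auto simp: lookup_add lookup_minus lookup_single when_def in_keys_iff)
      then show ?case using False j'(2) 1 by auto
    qed
    also have "\<dots> = sgn_coeff j \<sigma> * (sgn_coeff j \<sigma> * Poly_Mapping.lookup (f \<sigma>) w)"
      using j'(1) by simp
    also have "\<dots> = Poly_Mapping.lookup (f \<sigma>) w"
      by (simp add: sq flip: mult.assoc)
    finally show ?thesis using False by (simp add: lookup_minus)
  next
    case True
    define \<rho> where "\<rho> = \<sigma> - {j}"
    have \<rho>: "\<rho> \<in> faces n p" "finite \<rho>" "j \<notin> \<rho>" "insert j \<rho> = \<sigma>"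
      using faces_remove[OF True \<sigma>] fin True by (auto simp: \<rho>_def)
    have jn: "j \<in> {1..n}" using True \<sigma> by (auto simp: faces_def)
    \<comment> \<open>\<open>t i\<close> is the summand for \<open>i\<close> in the coefficient of
      x_j w e_\<rho> in \<partial>f. The next two facts show that the coefficient of \<partial>(h f)
      consists of these summands with sign reversed, while that of \<partial>f has one more, for i =
      j, which yields f(\<sigma>).\<close>
    define t where "t i = sgn_coeff i \<rho> * (if i \<in> Poly_Mapping.keys w
      then Poly_Mapping.lookup (f (insert i \<rho>)) (w - var i + var j) else 0)" for i
    have "Poly_Mapping.lookup (poly_diff n (Suc p) (contraction m n (Suc p) f) \<sigma>) w =
      (\<Sum>i\<in>{1..n} - \<sigma>. - (sgn_coeff j \<rho> * t i))"
      unfolding 1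
    proof (intro sum.cong refl, goal_cases)
      case (1 i)
      then have i: "i \<notin> \<rho>" "i \<noteq> j" "insert i \<sigma> - {j} = insert i \<rho>"
        using True by (auto simp: \<rho>_def)
      let ?A = "sgn_coeff i \<rho> :: 'k" and ?B = "sgn_coeff j (insert i \<rho>) :: 'k"
        and ?C = "sgn_coeff j \<rho> :: 'k" and ?D = "sgn_coeff i \<sigma> :: 'k"
      have "?A * ?B = - (?C * ?D)"
        using class_cring.koszul_sgn_swap[OF \<rho>(2) i(1) \<rho>(3) i(2)] \<rho>(4) by simp
      \<comment> \<open>Multiplying the swap relation by \<open>?A * ?D\<close> and using that
        squares of signs are 1 moves the signs to the sides where they are needed.\<close>
      moreover have "(?A * ?A) * (?D * ?B) = (?A * ?B) * (?A * ?D)" by (simp only: ac_simps)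
      ultimately have "(?A * ?A) * (?D * ?B) = - ((?D * ?D) * (?C * ?A))"
        by (simp add: ac_simps)
      then have "?D * ?B = - (?C * ?A)" by (simp add: sq)
      then show ?case using True by (simp add: i t_def flip: mult.assoc)
    qed
    moreover have "Poly_Mapping.lookup (poly_diff n p f \<rho>) (w + var j) =
      sgn_coeff j \<rho> * Poly_Mapping.lookup (f \<sigma>) w + (\<Sum>i\<in>{1..n} - \<sigma>. t i)"
    proof -
      have eq: "{1..n} - \<rho> = insert j ({1..n} - \<sigma>)" using jn by (auto simp: \<rho>_def)
      have "t i = sgn_coeff i \<rho> * (if i \<in> Poly_Mapping.keys (w + var j)
        then Poly_Mapping.lookup (f (insert i \<rho>)) (w + var j - var i) else 0)"
        if i: "i \<in> {1..n} - \<sigma>" for i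
      proof -
        have "i \<noteq> j" using i True by auto
        then have "w + var j - var i = w - var i + var j"
          "i \<in> Poly_Mapping.keys (w + var j) \<longleftrightarrow> i \<in> Poly_Mapping.keys w"
          by (auto intro!: poly_mapping_eqI simp: lookup_add lookup_minus lookup_single when_def keys_add_nat)
        then show ?thesis by (simp add: t_def)
      qed
      then show ?thesis
        unfolding lookup_poly_diff[OF f \<rho>(1)] eq using True \<rho>(4) by (simp add: keys_add_nat)
    qed
    ultimately show ?thesis
      using True by (simp add: lookup_minus sum_negf distrib_left sq
        flip: \<rho>_def mult.assoc sum_distrib_left)
  qed
qed


section \<open>Stable ideals\<close>

lemma sum_single_lookup:
  "(\<Sum>w\<in>Poly_Mapping.keys f. Poly_Mapping.single w (Poly_Mapping.lookup f w)) = f"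
  by (intro poly_mapping_eqI) (simp add: lookup_sum lookup_single when_def in_keys_iff)

lemma xpow_add: "xpow (u + v) = xpow u * (xpow v :: 'k::field mpoly)"
  by (simp add: xpow_def mult_single)

lemma add_in_monomials_iff: "u + v \<in> monomials n \<longleftrightarrow> u \<in> monomials n \<and> v \<in> monomials n"
  by (auto simp: monomials_def keys_add_nat)

lemma add_diff_var:
  "j \<in> Poly_Mapping.keys v \<Longrightarrow> w + var j = u + v \<Longrightarrow> w = u + (v - var j)"
  by (intro poly_mapping_eqI, drule_tac f="\<lambda>f. Poly_Mapping.lookup f k" in arg_cong)
    (auto simp: lookup_add lookup_minus lookup_single when_def in_keys_iff split: if_splits)

lemma max_var_mem: "w \<noteq> 0 \<Longrightarrow> max_var w \<in> Poly_Mapping.keys w"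
  unfolding max_var_def by (intro Max_in) auto

section \<open>Membership in a monomial ideal\<close>

locale monomial_ideal_quotient =
  fixes n :: nat and I :: "'k::field mpoly set"
  assumes monomial_ideal: "monomial_ideal n I"
begin

abbreviation P :: "'k mpoly ring" where "P \<equiv> poly_ring n"

sublocale P: cring P by (rule cring_poly_ring)

sublocale I: ideal I P
proof -
  obtain M where M: "M \<subseteq> monomials n" "I = Idl\<^bsub>P\<^esub> (xpow ` M)"
    using monomial_ideal by (auto simp: monomial_ideal_def)
  show "ideal I P"
    unfolding M(2) using M(1) xpow_in_poly_ring by (intro P.genideal_ideal) blast
qed

lemma xpow_add_mem:
  assumes "xpow u \<in> I" "u + v \<in> monomials n"
  shows "xpow (u + v) \<in> I"
proof -
  have "xpow v \<in> carrier P" using assms(2) by (intro xpow_in_poly_ring) (simp add: add_in_monomials_iff)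
  then have "xpow v \<otimes>\<^bsub>P\<^esub> xpow u \<in> I" using assms(1) by (intro I.I_l_closed)
  then show ?thesis by (simp add: xpow_add mult.commute)
qed

lemma sum_mem: "(\<And>a. a \<in> A \<Longrightarrow> f a \<in> I) \<Longrightarrow> sum f A \<in> I"
proof (induction A rule: infinite_finite_induct)
  case (insert a A)
  then have "f a \<oplus>\<^bsub>P\<^esub> sum f A \<in> I" by (intro I.a_closed) auto
  with insert show ?case by simp
qed (use I.zero_closed in simp_all)

text \<open>Each monomial of an element of I is a multiple of a minimal generator, and conversely f
  is a linear combination of its monomials. Cycles modulo I can therefore be recognised coefficient
  by coefficient.\<close>

lemma mem_iff: "f \<in> I \<longleftrightarrow> f \<in> carrier P \<and> (\<forall>w\<in>Poly_Mapping.keys f. xpow w \<in> I)"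
proof safe
  assume f: "f \<in> I"
  then show fP: "f \<in> carrier P" by (rule I.Icarr)
  fix w assume w: "w \<in> Poly_Mapping.keys f"
  have "min_gens n I \<subseteq> monomials n" by (auto simp: min_gens_def)
  moreover have "f \<in> Idl\<^bsub>P\<^esub> (xpow ` min_gens n I)"
    using f Idl_min_gens[OF monomial_ideal] by simp
  ultimately obtain u v where "u \<in> min_gens n I" "w = u + v"
    using mem_monomial_ideal_keys w by blast
  moreover have "w \<in> monomials n" using w fP by auto
  ultimately show "xpow w \<in> I" using xpow_add_mem by (auto simp: min_gens_def)
next
  assume f: "f \<in> carrier P" and w: "\<forall>w\<in>Poly_Mapping.keys f. xpow w \<in> I"
  have "Poly_Mapping.single w (Poly_Mapping.lookup f w) \<in> I" if "w \<in> Poly_Mapping.keys f" for w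
  proof -
    have "Poly_Mapping.single 0 (Poly_Mapping.lookup f w) \<otimes>\<^bsub>P\<^esub> xpow w \<in> I"
      using w that by (intro I.I_l_closed) auto
    then show ?thesis by (simp add: xpow_def mult_single)
  qed
  then have "(\<Sum>w\<in>Poly_Mapping.keys f. Poly_Mapping.single w (Poly_Mapping.lookup f w)) \<in> I"
    by (rule sum_mem)
  also have "(\<Sum>w\<in>Poly_Mapping.keys f. Poly_Mapping.single w (Poly_Mapping.lookup f w)) = f"
    by (rule sum_single_lookup)
  finally show "f \<in> I" .
qed

lemma obtain_min_gen:
  assumes "xpow w \<in> I"
  obtains u v where "u \<in> min_gens n I" "w = u + v"
proof -
  have "min_gens n I \<subseteq> monomials n" by (auto simp: min_gens_def)
  moreover have "xpow w \<in> Idl\<^bsub>P\<^esub> (xpow ` min_gens n I)"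
    using assms Idl_min_gens[OF monomial_ideal] by simp
  moreover have "w \<in> Poly_Mapping.keys (xpow w :: 'k mpoly)" by (simp add: xpow_def)
  ultimately show ?thesis using mem_monomial_ideal_keys that by blast
qed

section \<open>Index choices obtained from stability\<close>

text \<open>What the contraction argument asks of the chosen index j: it must lie in the support of
  the multidegree, and x_j w in I for j in \<sigma> must make \<open>w e_\<sigma>\<close> a cycle
  modulo I. Both kinds of stability reach the homology only through this property. A nonempty
  \<sigma> guarantees that the multidegree has nonempty support.\<close>

definition pivot :: "((nat \<Rightarrow>\<^sub>0 nat) \<Rightarrow> nat) \<Rightarrow> bool" where
  "pivot m \<longleftrightarrow> (\<forall>\<sigma> w. \<sigma> \<subseteq> {1..n} \<longrightarrow> \<sigma> \<noteq> {} \<longrightarrow> w \<in> monomials n \<longrightarrow>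
    m (w + face_mon \<sigma>) \<in> Poly_Mapping.keys (w + face_mon \<sigma>) \<and>
    (m (w + face_mon \<sigma>) \<in> \<sigma> \<longrightarrow> xpow (w + var (m (w + face_mon \<sigma>))) \<in> I \<longrightarrow>
      (\<forall>i\<in>\<sigma>. xpow (w + var i) \<in> I)))"

text \<open>A minimal generator u dividing x_j w does not divide w, as w is outside I; so x_j does
  not divide the cofactor v. Hence x_j divides u, and since j bounds the support of w, max(u) = j.
  Then w = v (u/x_j), so x_i w is a multiple of x_i u/x_j, the monomial to which stability
  applies.\<close>

lemma exchange:
  assumes w: "w \<in> monomials n" "\<And>i. i \<in> Poly_Mapping.keys w \<Longrightarrow> i \<le> j"
    and wj: "xpow (w + var j) \<in> I" "xpow w \<notin> I"
  obtains u v where "u \<in> min_gens n I" "max_var u = j" "w + var j = u + v"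
    "\<And>i. i \<in> {1..n} \<Longrightarrow> xpow (var i + (u - var j)) \<in> I \<Longrightarrow> xpow (w + var i) \<in> I"
proof -
  obtain u v where u: "u \<in> min_gens n I" "w + var j = u + v" using obtain_min_gen[OF wj(1)] .
  have jv: "j \<notin> Poly_Mapping.keys v"
  proof
    assume "j \<in> Poly_Mapping.keys v"
    then have "w = u + (v - var j)" using u(2) by (rule add_diff_var)
    then show False using xpow_add_mem[of u "v - var j"] u(1) w(1) wj(2) by (auto simp: min_gens_def)
  qed
  have keys: "Poly_Mapping.keys u \<union> Poly_Mapping.keys v = insert j (Poly_Mapping.keys w)"
    using arg_cong[OF u(2), of Poly_Mapping.keys] by (auto simp: keys_add_nat)
  have ju: "j \<in> Poly_Mapping.keys u" using keys jv by auto
  have "max_var u = j"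
    unfolding max_var_def
  proof (rule Max_eqI)
    fix y assume "y \<in> Poly_Mapping.keys u"
    then have "y = j \<or> y \<in> Poly_Mapping.keys w" using keys by blast
    then show "y \<le> j" using w(2) by blast
  qed (use ju in simp_all)
  moreover have "xpow (w + var i) \<in> I" if i: "i \<in> {1..n}" "xpow (var i + (u - var j)) \<in> I" for i
  proof -
    have "w = v + (u - var j)"
      using u(2) by (intro add_diff_var[OF ju]) (simp add: add.commute)
    then have "w + var i = (var i + (u - var j)) + v" by (simp add: ac_simps)
    moreover have "w + var i \<in> monomials n"
      using w(1) i(1) var_in_monomials by (simp add: add_in_monomials_iff)
    ultimately show ?thesis using xpow_add_mem[OF i(2)] by simp
  qed
  ultimately show ?thesis using that u by blast
qed

text \<open>The maximum of the multidegree bounds both the support of w and all of \<sigma>. The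
  generator from \<open>exchange\<close> thus satisfies i \<le> max(u) for every i in \<sigma>,
  which is the range of the stability condition.\<close>

lemma stable_pivot:
  assumes "stable_ideal n I"
  shows "pivot max_var"
  unfolding pivot_def
proof (intro allI impI conjI ballI)
  fix \<sigma> w assume \<sigma>: "\<sigma> \<subseteq> {1..n}" "\<sigma> \<noteq> {}" and w: "w \<in> monomials n"
  let ?a = "w + face_mon \<sigma>"
  have keys: "Poly_Mapping.keys ?a = Poly_Mapping.keys w \<union> \<sigma>"
    using finite_subset[OF \<sigma>(1) finite_atLeastAtMost] by (simp add: keys_add_nat keys_face_mon)
  show "max_var ?a \<in> Poly_Mapping.keys ?a"
    using keys \<sigma>(2) by (intro max_var_mem) auto
  fix i assume j: "max_var ?a \<in> \<sigma>" "xpow (w + var (max_var ?a)) \<in> I" and i: "i \<in> \<sigma>"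
  have le: "k \<le> max_var ?a" if "k \<in> Poly_Mapping.keys w \<union> \<sigma>" for k
    unfolding max_var_def using that keys by (intro Max_ge finite_keys) simp
  have wi: "w + var i \<in> monomials n"
    using w i \<sigma>(1) var_in_monomials by (auto simp: add_in_monomials_iff)
  show "xpow (w + var i) \<in> I"
  proof (cases "xpow w \<in> I")
    case True
    then show ?thesis using wi by (rule xpow_add_mem)
  next
    case False
    obtain u v where u: "u \<in> min_gens n I" "max_var u = max_var ?a"
      and ex: "\<And>i. i \<in> {1..n} \<Longrightarrow> xpow (var i + (u - var (max_var ?a))) \<in> I \<Longrightarrow> xpow (w + var i) \<in> I"
      using exchange[OF w _ j(2) False] le by blast
    have "i \<in> {1..n}" "i \<le> max_var u" using i \<sigma>(1) le u(2) by auto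
    then have "xpow (var i + (u - var (max_var u))) \<in> I"
      using assms u(1) unfolding stable_ideal_def by blast
    then show ?thesis using ex \<open>i \<in> {1..n}\<close> u(2) by simp
  qed
qed

text \<open>Squarefree stability permits only exchanges by variables not dividing u, which the
  maximal index guarantees when the multidegree is squarefree. In the remaining multidegrees an
  index of multiplicity at least 2 leaves nothing to exchange.\<close>

lemma squarefree_stable_pivot:
  assumes "squarefree_stable_ideal n I"
  shows "pivot (\<lambda>a. if squarefree_mon a then max_var a else SOME i. Poly_Mapping.lookup a i > 1)"
    (is "pivot ?m")
  unfolding pivot_def
proof (intro allI impI conjI ballI)
  fix \<sigma> w assume \<sigma>: "\<sigma> \<subseteq> {1..n}" "\<sigma> \<noteq> {}" and w: "w \<in> monomials n"
  let ?a = "w + face_mon \<sigma>"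
  have fin: "finite \<sigma>" using \<sigma>(1) by (rule finite_subset) simp
  then have keys: "Poly_Mapping.keys ?a = Poly_Mapping.keys w \<union> \<sigma>"
    by (simp add: keys_add_nat keys_face_mon)
  have m: "Poly_Mapping.lookup ?a (?m ?a) > 1" if a: "\<not> squarefree_mon ?a"
  proof -
    obtain i where "Poly_Mapping.lookup ?a i > 1" using a by (auto simp: squarefree_mon_def not_le)
    then show ?thesis using a someI[of "\<lambda>i. Poly_Mapping.lookup ?a i > 1" i] by simp
  qed
  show "?m ?a \<in> Poly_Mapping.keys ?a"
  proof (cases "squarefree_mon ?a")
    case True
    have "?a \<noteq> 0" using keys \<sigma>(2) by (auto simp flip: keys_eq_empty)
    then show ?thesis using True max_var_mem[of ?a] by simp
  next
    case False
    show ?thesis using m[OF False] by (simp only: in_keys_iff)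
  qed
  fix i assume j: "?m ?a \<in> \<sigma>" "xpow (w + var (?m ?a)) \<in> I" and i: "i \<in> \<sigma>"
  have wi: "w + var i \<in> monomials n"
    using w i \<sigma>(1) var_in_monomials by (auto simp: add_in_monomials_iff)
  show "xpow (w + var i) \<in> I"
  proof (cases "xpow w \<in> I")
    case True
    then show ?thesis using wi by (rule xpow_add_mem)
  next
    case wI: False
    \<comment> \<open>The face contributes at most one factor x_k, so multiplicity at least 2 forces
      x_k to divide w. Then x_k^2 divides x_k w = u v, where u is squarefree; so x_k divides v, and
      u already divides w, contrary to w being outside I.\<close>
    have sf: "squarefree_mon ?a"
    proof (rule ccontr)
      assume "\<not> squarefree_mon ?a"
      define k where "k = ?m ?a"
      have wk: "Poly_Mapping.lookup w k > 0"
        using m[OF \<open>\<not> squarefree_mon ?a\<close>] fin j(1) unfolding k_def[symmetric]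
        by (auto simp: lookup_add lookup_face_mon)
      obtain M where M: "M \<subseteq> monomials n" "\<forall>u\<in>M. squarefree_mon u" "I = Idl\<^bsub>P\<^esub> (xpow ` M)"
        using assms by (auto simp: squarefree_stable_ideal_def squarefree_monomial_ideal_def)
      obtain u v where u: "u \<in> min_gens n I" "w + var k = u + v"
        using obtain_min_gen[OF j(2)] unfolding k_def .
      then have "u \<in> M" using min_gens_least[OF M(1,3)] by blast
      then have "Poly_Mapping.lookup u k \<le> 1" using M(2) by (simp add: squarefree_mon_def)
      moreover have "Poly_Mapping.lookup w k + 1 = Poly_Mapping.lookup u k + Poly_Mapping.lookup v k"
        using arg_cong[OF u(2), of "\<lambda>f. Poly_Mapping.lookup f k"] by (simp add: lookup_add)
      ultimately have "k \<in> Poly_Mapping.keys v" using wk by (simp add: in_keys_iff)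
      then have "w = u + (v - var k)" using u(2) by (rule add_diff_var)
      then show False using xpow_add_mem[of u "v - var k"] u(1) w wI by (auto simp: min_gens_def)
    qed
    define k where "k = max_var ?a"
    have k: "k \<in> \<sigma>" "xpow (w + var k) \<in> I" using j sf by (simp_all add: k_def)
    have le: "k' \<le> k" if "k' \<in> Poly_Mapping.keys w \<union> \<sigma>" for k'
      unfolding k_def max_var_def using that fin by (intro Max_ge) (simp_all add: keys)
    show ?thesis
    proof (cases "i = k")
      case False
      obtain u v where u: "u \<in> min_gens n I" "max_var u = k" "w + var k = u + v"
        and ex: "\<And>i. i \<in> {1..n} \<Longrightarrow> xpow (var i + (u - var k)) \<in> I \<Longrightarrow> xpow (w + var i) \<in> I"
        using exchange[OF w _ k(2) wI] le by blast
      \<comment> \<open>As i in \<sigma> already uses up the multiplicity of i, the variable x_i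
        does not divide w. With i different from k it does not divide x_k w either, and hence not
        its divisor u.\<close>
      have "Poly_Mapping.lookup ?a i \<le> 1" using sf by (simp add: squarefree_mon_def)
      then have "Poly_Mapping.lookup w i = 0" using i fin by (simp add: lookup_add lookup_face_mon)
      then have "i \<notin> Poly_Mapping.keys (w + var k)" using False by (simp add: keys_add_nat in_keys_iff)
      then have "i \<notin> Poly_Mapping.keys u" unfolding u(3) by (simp add: keys_add_nat)
      moreover have "i \<in> {1..n}" "i < max_var u" using i \<sigma>(1) le[of i] u(2) False by auto
      ultimately have "xpow (var i + (u - var (max_var u))) \<in> I"
        using assms u(1) unfolding squarefree_stable_ideal_def by blast
      then show ?thesis using ex \<open>i \<in> {1..n}\<close> u(2) by simp
    qed (use k in simp)
  qed
qed

end


section \<open>Koszul homology\<close>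

context monomial_ideal_quotient
begin

abbreviation Q :: "'k mpoly set ring" where "Q \<equiv> quot_ring n I"

abbreviation residue :: "'k mpoly \<Rightarrow> 'k mpoly set" where "residue f \<equiv> I +>\<^bsub>P\<^esub> f"

abbreviation x :: "nat \<Rightarrow> 'k mpoly set" where "x \<equiv> residue_var n I"

sublocale Q: cring Q by (rule I.quotient_is_cring[OF P.is_cring])

sublocale residue: ring_hom_cring P Q residue
  by (rule I.rcos_ring_hom_cring[OF P.is_cring])

context
  notes One_nat_def [simp del]
begin

lemma xpow_var_closed: "(\<lambda>i. xpow (var i)) \<in> {1..n} \<rightarrow> carrier P"
  using xpow_in_poly_ring[OF var_in_monomials] by blast

lemma x_closed: "x \<in> {1..n} \<rightarrow> carrier Q"
  using xpow_var_closed by (auto simp: residue_mon_def simp del: poly_ring_simps)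

lemma residue_eq_zero_iff: "f \<in> carrier P \<Longrightarrow> residue f = \<zero>\<^bsub>Q\<^esub> \<longleftrightarrow> f \<in> I"
  using I.rcos_const_imp_mem P.a_rcos_zero[OF I.is_ideal] by (auto simp: FactRing_def)

section \<open>Reduction of chains modulo I\<close>

definition reduce :: "nat \<Rightarrow> (nat set \<Rightarrow> 'k mpoly) \<Rightarrow> nat set \<Rightarrow> 'k mpoly set" where
  "reduce p f = (\<lambda>\<sigma>\<in>faces n p. residue (f \<sigma>))"

lemma reduce_closed: "f \<in> faces n p \<rightarrow> carrier P \<Longrightarrow> reduce p f \<in> carrier (koszul_module Q n p)"
  by (auto simp: reduce_def simp del: poly_ring_simps)

lemma reduce_surj:
  assumes "z \<in> carrier (koszul_module Q n p)"
  obtains f where "f \<in> faces n p \<rightarrow>\<^sub>E carrier P" "z = reduce p f"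
proof -
  have z: "z \<in> faces n p \<rightarrow>\<^sub>E carrier Q" using assms by simp
  have "\<exists>g\<in>carrier P. z \<sigma> = residue g" if "\<sigma> \<in> faces n p" for \<sigma>
  proof -
    have "z \<sigma> \<in> carrier Q" using z that by auto
    then show ?thesis by (auto simp: FactRing_def A_RCOSETS_def' a_r_coset_def' simp del: poly_ring_simps)
  qed
  then obtain g where g: "\<And>\<sigma>. \<sigma> \<in> faces n p \<Longrightarrow> g \<sigma> \<in> carrier P \<and> z \<sigma> = residue (g \<sigma>)"
    by metis
  have "z = reduce p (restrict g (faces n p))"
    using z g by (auto simp: reduce_def fun_eq_iff PiE_iff extensional_def)
  moreover have "restrict g (faces n p) \<in> faces n p \<rightarrow>\<^sub>E carrier P" using g by auto
  ultimately show ?thesis using that by blast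
qed

lemma reduce_add:
  assumes "f \<in> faces n p \<rightarrow> carrier P" "g \<in> faces n p \<rightarrow> carrier P"
  shows "reduce p (\<lambda>\<sigma>. f \<sigma> + g \<sigma>) = reduce p f \<oplus>\<^bsub>koszul_module Q n p\<^esub> reduce p g"
proof
  fix \<sigma>
  have "residue (f \<sigma> \<oplus>\<^bsub>P\<^esub> g \<sigma>) = residue (f \<sigma>) \<oplus>\<^bsub>Q\<^esub> residue (g \<sigma>)" if "\<sigma> \<in> faces n p"
    using assms that by (intro residue.hom_add) auto
  then show "reduce p (\<lambda>\<sigma>. f \<sigma> + g \<sigma>) \<sigma> = (reduce p f \<oplus>\<^bsub>koszul_module Q n p\<^esub> reduce p g) \<sigma>"
    by (auto simp: reduce_def)
qed

lemma koszul_diff_reduce: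
  assumes "f \<in> faces n (Suc p) \<rightarrow> carrier P"
  shows "koszul_diff Q x n p (reduce (Suc p) f) = reduce p (poly_diff n p f)"
  using residue.koszul_diff_hom[OF xpow_var_closed assms]
  by (simp add: reduce_def[abs_def] residue_mon_def[abs_def])

lemma poly_diff_closed:
  "f \<in> faces n (Suc p) \<rightarrow>\<^sub>E carrier P \<Longrightarrow> poly_diff n p f \<in> faces n p \<rightarrow>\<^sub>E carrier P"
  by (rule P.koszul_diff_closed[OF xpow_var_closed])

text \<open>Reduction commutes with the differential, and membership in I is tested on
  monomials.\<close>

lemma reduce_mem_cycles_iff:
  assumes f: "f \<in> faces n (Suc p) \<rightarrow>\<^sub>E carrier P"
  shows "reduce (Suc p) f \<in> koszul_cycles Q x n (Suc p) \<longleftrightarrow>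
    (\<forall>\<tau>\<in>faces n p. \<forall>w\<in>Poly_Mapping.keys (poly_diff n p f \<tau>). xpow w \<in> I)"
proof -
  have f': "f \<in> faces n (Suc p) \<rightarrow> carrier P" using f by (auto simp: PiE_iff)
  have "residue (poly_diff n p f \<tau>) = \<zero>\<^bsub>Q\<^esub> \<longleftrightarrow>
      (\<forall>w\<in>Poly_Mapping.keys (poly_diff n p f \<tau>). xpow w \<in> I)" if "\<tau> \<in> faces n p" for \<tau>
  proof -
    have "poly_diff n p f \<tau> \<in> carrier P"
      using poly_diff_closed[OF f] that by (auto simp: PiE_iff)
    then show ?thesis using residue_eq_zero_iff mem_iff[of "poly_diff n p f \<tau>"] by blast
  qed
  then have "reduce p (poly_diff n p f) = \<zero>\<^bsub>koszul_module Q n p\<^esub> \<longleftrightarrow>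
      (\<forall>\<tau>\<in>faces n p. \<forall>w\<in>Poly_Mapping.keys (poly_diff n p f \<tau>). xpow w \<in> I)"
    by (auto simp: reduce_def fun_eq_iff restrict_def simp del: poly_ring_simps)
  then show ?thesis
    using reduce_closed[OF f'] koszul_diff_reduce[OF f']
    by (simp add: koszul_cycles_def del: koszul_module_simps poly_ring_simps)
qed

section \<open>Single terms and monomial cycles\<close>

text \<open>The term \<open>c w e_\<rho>\<close> over S. Keeping the scalar in the polynomial makes
  every polynomial chain a sum of such terms.\<close>

definition mon_chain :: "nat \<Rightarrow> (nat \<Rightarrow>\<^sub>0 nat) \<Rightarrow> 'k \<Rightarrow> nat set \<Rightarrow> nat set \<Rightarrow> 'k mpoly" where
  "mon_chain p w c \<rho> = (\<lambda>\<sigma>\<in>faces n p. if \<sigma> = \<rho> then Poly_Mapping.single w c else 0)"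

lemma mon_chain_closed: "w \<in> monomials n \<Longrightarrow> mon_chain p w c \<rho> \<in> faces n p \<rightarrow>\<^sub>E carrier P"
  by (auto simp: mon_chain_def)

lemma residue_zero: "residue 0 = \<zero>\<^bsub>Q\<^esub>"
  using residue.hom_zero by simp

lemma koszul_elem_residue_mon:
  "koszul_elem Q n p (residue_mon n I w) \<rho> = reduce p (mon_chain p w 1 \<rho>)"
  by (simp add: koszul_elem_def reduce_def mon_chain_def residue_mon_def xpow_def residue_zero fun_eq_iff)

text \<open>The boundary of \<open>w e_\<rho>\<close> is the signed sum of the terms x_i w e_{\<rho>
  - {i}}, so it vanishes modulo I once all x_i w lie in I.\<close>

lemma koszul_elem_monomial_cycle:
  assumes w: "w \<in> monomials n" and \<rho>: "\<rho> \<in> faces n (Suc p)" and wi: "\<And>i. i \<in> \<rho> \<Longrightarrow> xpow (w + var i) \<in> I"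
  shows "koszul_elem Q n (Suc p) (residue_mon n I w) \<rho> \<in> monomial_cycles n I (Suc p)"
proof -
  let ?f = "mon_chain (Suc p) w 1 \<rho>"
  have f: "?f \<in> faces n (Suc p) \<rightarrow>\<^sub>E carrier P" using w by (rule mon_chain_closed)
  then have f': "?f \<in> faces n (Suc p) \<rightarrow> carrier P" by (auto simp: PiE_iff)
  have "xpow v \<in> I" if \<tau>: "\<tau> \<in> faces n p" and v: "v \<in> Poly_Mapping.keys (poly_diff n p ?f \<tau>)" for \<tau> v
  proof -
    have "(\<Sum>i\<in>{1..n} - \<tau>. sgn_coeff i \<tau> * (if i \<in> Poly_Mapping.keys v
        then Poly_Mapping.lookup (?f (insert i \<tau>)) (v - var i) else 0)) \<noteq> 0"
      using v unfolding in_keys_iff lookup_poly_diff[OF f' \<tau>] .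
    \<comment> \<open>A nonzero coefficient needs a nonzero summand, which identifies the face as
      \<rho> and the monomial v as x_i w with i in \<rho>.\<close>
    then obtain i where i: "i \<in> {1..n} - \<tau>" "i \<in> Poly_Mapping.keys v"
      "Poly_Mapping.lookup (?f (insert i \<tau>)) (v - var i) \<noteq> 0"
      by (auto elim!: sum.not_neutral_contains_not_neutral split: if_splits)
    then have "insert i \<tau> = \<rho>" "v - var i = w"
      using faces_insert[OF i(1) \<tau>]
      by (auto simp: mon_chain_def lookup_single when_def split: if_splits)
    moreover have "v = (v - var i) + var i"
      using i(2) by (intro poly_mapping_eqI)
        (auto simp: lookup_add lookup_minus lookup_single when_def in_keys_iff)
    ultimately show ?thesis using wi[of i] by auto
  qed
  then have "reduce (Suc p) ?f \<in> koszul_cycles Q x n (Suc p)"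
    using reduce_mem_cycles_iff[OF f] by blast
  then show ?thesis
    using w \<rho> by (auto simp: monomial_cycles_def koszul_elem_residue_mon)
qed

section \<open>Homology classes and the span of the monomial cycles\<close>

abbreviation cls :: "nat \<Rightarrow> (nat set \<Rightarrow> 'k mpoly set) \<Rightarrow> (nat set \<Rightarrow> 'k mpoly set) set" where
  "cls p \<equiv> koszul_class Q x n p"

lemma cycle_module: "Module.module Q (koszul_cycle_module Q x n p)"
  unfolding koszul_cycle_module_def
  by (rule submodule.submodule_is_module[OF Q.koszul_cycles_submodule[OF x_closed] Q.koszul_module_module])

lemma cycle_module_simps:
  "f \<oplus>\<^bsub>koszul_cycle_module Q x n p\<^esub> g = f \<oplus>\<^bsub>koszul_module Q n p\<^esub> g"
  "r \<odot>\<^bsub>koszul_cycle_module Q x n p\<^esub> f = r \<odot>\<^bsub>koszul_module Q n p\<^esub> f"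
  "\<zero>\<^bsub>koszul_cycle_module Q x n p\<^esub> = \<zero>\<^bsub>koszul_module Q n p\<^esub>"
  "carrier (koszul_cycle_module Q x n p) = koszul_cycles Q x n p"
  by (simp_all add: koszul_cycle_module_def)

lemmas quot_facts = cycle_module Q.koszul_boundaries_submodule[OF x_closed]

lemma carrier_homology: "carrier (homology n I p) = cls p ` koszul_cycles Q x n p"
  using carrier_quot_module[OF quot_facts[of p]]
  by (simp add: homology_def restrict_scalars_def koszul_homology_def koszul_class_def[abs_def]
      cycle_module_simps)

lemma homology_zero: "\<zero>\<^bsub>homology n I p\<^esub> = cls p \<zero>\<^bsub>koszul_module Q n p\<^esub>"
  using quot_module_zero[OF quot_facts[of p]]
  by (simp add: homology_def restrict_scalars_def koszul_homology_def koszul_class_def cycle_module_simps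
      del: koszul_module_simps)

lemma homology_add:
  assumes "z \<in> koszul_cycles Q x n p" "z' \<in> koszul_cycles Q x n p"
  shows "cls p z \<oplus>\<^bsub>homology n I p\<^esub> cls p z' = cls p (z \<oplus>\<^bsub>koszul_module Q n p\<^esub> z')"
  using quot_module_add[OF quot_facts[of p], of z z'] assms
  by (simp add: homology_def restrict_scalars_def koszul_homology_def koszul_class_def cycle_module_simps
      del: koszul_module_simps)

lemma residue_const_closed: "residue_const n I c \<in> carrier Q"
  unfolding residue_const_def by (rule residue.hom_closed) simp

lemma homology_smult:
  assumes "z \<in> koszul_cycles Q x n p"
  shows "c \<odot>\<^bsub>homology n I p\<^esub> cls p z = cls p (residue_const n I c \<odot>\<^bsub>koszul_module Q n p\<^esub> z)"
  using quot_module_smult[OF quot_facts[of p], of "residue_const n I c" z] assms residue_const_closed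
  by (simp add: homology_def restrict_scalars_def koszul_homology_def koszul_class_def cycle_module_simps
      del: koszul_module_simps)

lemma class_add_boundary:
  assumes "z \<in> koszul_cycles Q x n p" "b \<in> koszul_boundaries Q x n p"
  shows "cls p (z \<oplus>\<^bsub>koszul_module Q n p\<^esub> b) = cls p z"
  using quot_module_absorb[OF quot_facts[of p], of z b] assms
  by (simp add: koszul_class_def cycle_module_simps
      del: koszul_module_simps)

text \<open>Writes a reduced term as a scalar from k acting on a monomial chain, so that its class
  becomes a scalar multiple of the class of that chain.\<close>

lemma reduce_mon_chain:
  assumes "w \<in> monomials n"
  shows "reduce p (mon_chain p w c \<rho>) =
    residue_const n I c \<odot>\<^bsub>koszul_module Q n p\<^esub> koszul_elem Q n p (residue_mon n I w) \<rho>"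
proof
  fix \<sigma>
  have "residue (Poly_Mapping.single 0 c \<otimes>\<^bsub>P\<^esub> xpow w) = residue_const n I c \<otimes>\<^bsub>Q\<^esub> residue_mon n I w"
    unfolding residue_const_def residue_mon_def
    by (intro residue.hom_mult xpow_in_poly_ring assms) simp
  then have 1: "residue (Poly_Mapping.single w c) = residue_const n I c \<otimes>\<^bsub>Q\<^esub> residue_mon n I w"
    by (simp add: xpow_def mult_single)
  have "residue_const n I c \<otimes>\<^bsub>Q\<^esub> \<zero>\<^bsub>Q\<^esub> = \<zero>\<^bsub>Q\<^esub>"
    using residue_const_closed by (rule Q.r_null)
  then show "reduce p (mon_chain p w c \<rho>) \<sigma> =
    (residue_const n I c \<odot>\<^bsub>koszul_module Q n p\<^esub> koszul_elem Q n p (residue_mon n I w) \<rho>) \<sigma>"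
    by (simp add: koszul_elem_def reduce_def mon_chain_def 1 residue_zero)
qed

text \<open>By hypothesis each term of f reduces to a scalar multiple of a monomial cycle, and f is
  the finite sum of its terms. The two conclusions are proved together because classes may be added
  only for cycles.\<close>

lemma class_reduce_in_span:
  assumes f: "f \<in> faces n (Suc p) \<rightarrow> carrier P"
    and fw: "\<And>\<sigma> w i. \<sigma> \<in> faces n (Suc p) \<Longrightarrow> w \<in> Poly_Mapping.keys (f \<sigma>) \<Longrightarrow> i \<in> \<sigma> \<Longrightarrow> xpow (w + var i) \<in> I"
  shows "reduce (Suc p) f \<in> koszul_cycles Q x n (Suc p)" (is ?cyc)
    and "cls (Suc p) (reduce (Suc p) f) \<in>
      LinearCombinations.module.span class_ring (homology n I (Suc p))
        (cls (Suc p) ` monomial_cycles n I (Suc p))"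
      (is ?spn)
proof -
  interpret V: vectorspace class_ring "homology n I (Suc p)"
    by (rule vectorspace_homology[OF I.is_ideal])
  let ?K = "koszul_module Q n (Suc p)"
  let ?Z = "koszul_cycles Q x n (Suc p)"
  define S where "S = V.span (cls (Suc p) ` monomial_cycles n I (Suc p))"
  \<comment> \<open>The cycles with class in the span: this set contains the monomial cycles and is
    closed under addition and scalars, so it suffices to build the reduction of f inside it.\<close>
  define G where "G = {z \<in> ?Z. cls (Suc p) z \<in> S}"
  have mc: "cls (Suc p) ` monomial_cycles n I (Suc p) \<subseteq> carrier (homology n I (Suc p))"
    unfolding carrier_homology by (auto simp: monomial_cycles_def)
  have "LinearCombinations.submodule class_ring S (homology n I (Suc p))"
    unfolding S_def using mc by (rule V.span_is_submodule)
  then interpret S: LinearCombinations.submodule class_ring S "homology n I (Suc p)" .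
  interpret Z: Module.module Q "koszul_cycle_module Q x n (Suc p)" by (rule cycle_module)
  note Z_closed = Z.M.zero_closed Z.M.a_closed Z.smult_closed
  note Z_closed = Z_closed[unfolded cycle_module_simps]
  have G_zero: "\<zero>\<^bsub>?K\<^esub> \<in> G"
    using Z_closed(1) S.zero_closed
    by (simp add: G_def homology_zero[symmetric] del: koszul_module_simps)
  have G_add: "z \<oplus>\<^bsub>?K\<^esub> z' \<in> G" if "z \<in> G" "z' \<in> G" for z z'
    using that Z_closed(2)[of z z'] S.m_closed
    by (auto simp: G_def homology_add[symmetric] simp del: koszul_module_simps)
  have G_smult: "residue_const n I c \<odot>\<^bsub>?K\<^esub> z \<in> G" if "z \<in> G" for c z
    using that Z_closed(3)[OF residue_const_closed] S.smult_closed[of c]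
    by (auto simp: G_def homology_smult[symmetric] simp del: koszul_module_simps)
  have G_mon: "z \<in> G" if z: "z \<in> monomial_cycles n I (Suc p)" for z
    using z V.in_own_span[OF mc] by (auto simp: G_def S_def monomial_cycles_def)
  define T where "T = (SIGMA \<sigma>:faces n (Suc p). Poly_Mapping.keys (f \<sigma>))"
  define g where "g = (\<lambda>(\<rho>, w). mon_chain (Suc p) w (Poly_Mapping.lookup (f \<rho>) w) \<rho>)"
  have fin: "finite T"
    unfolding T_def by (intro finite_SigmaI) (auto simp: faces_def)
  have g: "g t \<in> faces n (Suc p) \<rightarrow> carrier P" "reduce (Suc p) (g t) \<in> G" if t: "t \<in> T" for t
  proof -
    obtain \<rho> w where t: "t = (\<rho>, w)" "\<rho> \<in> faces n (Suc p)" "w \<in> Poly_Mapping.keys (f \<rho>)"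
      using t by (auto simp: T_def)
    then have w: "w \<in> monomials n" using f by auto
    show "g t \<in> faces n (Suc p) \<rightarrow> carrier P"
      using mon_chain_closed[OF w] by (simp only: g_def t(1) prod.case PiE_def Int_iff)
    show "reduce (Suc p) (g t) \<in> G"
      unfolding g_def t(1) prod.case reduce_mon_chain[OF w]
      by (intro G_smult G_mon koszul_elem_monomial_cycle w t(2) fw[OF t(2,3)])
  qed
  \<comment> \<open>The induction also carries the fact that partial sums are polynomial chains, as
    additivity of \<open>reduce\<close> requires.\<close>
  have G_sum: "(\<lambda>\<sigma>. \<Sum>t\<in>T'. g t \<sigma>) \<in> faces n (Suc p) \<rightarrow> carrier P \<and>
      reduce (Suc p) (\<lambda>\<sigma>. \<Sum>t\<in>T'. g t \<sigma>) \<in> G" if "T' \<subseteq> T" for T'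
    using finite_subset[OF that fin] that
  proof (induction T' rule: finite_induct)
    case empty
    have "reduce (Suc p) (\<lambda>\<sigma>. 0) = \<zero>\<^bsub>?K\<^esub>" by (simp add: reduce_def residue_zero)
    then have "reduce (Suc p) (\<lambda>\<sigma>. 0) \<in> G" using G_zero by (simp only:)
    then show ?case unfolding sum.empty by (intro conjI Pi_I) simp_all
  next
    case (insert t T')
    have gt: "g t \<in> faces n (Suc p) \<rightarrow> carrier P" "reduce (Suc p) (g t) \<in> G"
      using g[of t] insert.prems by (simp_all only: insert_subset)
    have IH: "(\<lambda>\<sigma>. \<Sum>t\<in>T'. g t \<sigma>) \<in> faces n (Suc p) \<rightarrow> carrier P"
      "reduce (Suc p) (\<lambda>\<sigma>. \<Sum>t\<in>T'. g t \<sigma>) \<in> G"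
      using insert.IH insert.prems by (simp_all only: insert_subset)
    have "(\<lambda>\<sigma>. g t \<sigma> \<oplus>\<^bsub>P\<^esub> (\<Sum>t\<in>T'. g t \<sigma>)) \<in> faces n (Suc p) \<rightarrow> carrier P"
      using gt(1) IH(1) by (intro Pi_I P.a_closed) (rule funcset_mem; assumption)+
    moreover have "reduce (Suc p) (\<lambda>\<sigma>. g t \<sigma> + (\<Sum>t\<in>T'. g t \<sigma>)) \<in> G"
      unfolding reduce_add[OF gt(1) IH(1)] using gt(2) IH(2) by (rule G_add)
    ultimately show ?case by (simp only: sum.insert[OF insert.hyps] poly_ring_simps(3))
  qed
  have "reduce (Suc p) (\<lambda>\<sigma>. \<Sum>t\<in>T. g t \<sigma>) = reduce (Suc p) f"
  proof -
    have "(\<Sum>t\<in>T. g t \<sigma>) = f \<sigma>" if \<sigma>: "\<sigma> \<in> faces n (Suc p)" for \<sigma>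
    proof -
      \<comment> \<open>At the coordinate \<sigma> only the terms whose face is \<sigma> are
        nonzero.\<close>
      have "(\<Sum>t\<in>T. g t \<sigma>) = (\<Sum>t\<in>{\<sigma>} \<times> Poly_Mapping.keys (f \<sigma>). g t \<sigma>)"
        using \<sigma> fin by (intro sum.mono_neutral_right)
          (auto simp: T_def g_def mon_chain_def split: if_splits)
      also have "\<dots> = (\<Sum>w\<in>Poly_Mapping.keys (f \<sigma>). g (\<sigma>, w) \<sigma>)"
        by (simp only: sum.cartesian_product') simp
      also have "\<dots> = (\<Sum>w\<in>Poly_Mapping.keys (f \<sigma>). Poly_Mapping.single w (Poly_Mapping.lookup (f \<sigma>) w))"
        using \<sigma> by (simp add: g_def mon_chain_def)
      also have "\<dots> = f \<sigma>" by (rule sum_single_lookup)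
      finally show ?thesis .
    qed
    then show ?thesis unfolding reduce_def by (intro restrict_ext) simp
  qed
  then have "reduce (Suc p) f \<in> G" using G_sum[OF subset_refl] by (simp only:)
  then show ?cyc ?spn by (simp_all only: G_def S_def mem_Collect_eq)
qed

text \<open>Subtracting the boundary of the contraction from a lift f of z keeps the homology class.
  By the homotopy identity every remaining term has its chosen index j in \<sigma> and x_j w in I,
  and \<open>pivot\<close> turns each such term into a monomial cycle.\<close>

lemma class_in_span:
  assumes m: "pivot m" and z: "z \<in> koszul_cycles Q x n (Suc p)"
  shows "cls (Suc p) z \<in> LinearCombinations.module.span class_ring (homology n I (Suc p))
    (cls (Suc p) ` monomial_cycles n I (Suc p))"
proof -
  have "z \<in> carrier (koszul_module Q n (Suc p))" using z by (simp add: koszul_cycles_def)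
  then obtain f where f: "f \<in> faces n (Suc p) \<rightarrow>\<^sub>E carrier P" and zf: "z = reduce (Suc p) f"
    by (rule reduce_surj)
  then have f': "f \<in> faces n (Suc p) \<rightarrow> carrier P" by (auto simp: PiE_iff)
  define g where "g = contraction m n (Suc p) f"
  have g: "g \<in> faces n (Suc (Suc p)) \<rightarrow>\<^sub>E carrier P"
    unfolding g_def using f' by (rule contraction_closed)
  then have g': "g \<in> faces n (Suc (Suc p)) \<rightarrow> carrier P" by (auto simp: PiE_iff)
  define b where "b = poly_diff n (Suc p) g"
  have b: "b \<in> faces n (Suc p) \<rightarrow> carrier P"
    using poly_diff_closed[OF g] unfolding b_def by (auto simp: PiE_iff)
  define h where "h = (\<lambda>\<sigma>. f \<sigma> - b \<sigma>)"
  have h: "h \<in> faces n (Suc p) \<rightarrow> carrier P"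
  proof
    fix \<sigma> assume \<sigma>: "\<sigma> \<in> faces n (Suc p)"
    then have "Poly_Mapping.keys (f \<sigma>) \<subseteq> monomials n" "Poly_Mapping.keys (b \<sigma>) \<subseteq> monomials n"
      using f' b by auto
    then show "h \<sigma> \<in> carrier P" using keys_diff[of "f \<sigma>" "b \<sigma>"] by (auto simp: h_def)
  qed
  have hI: "xpow (w + var i) \<in> I"
    if \<sigma>: "\<sigma> \<in> faces n (Suc p)" and w: "w \<in> Poly_Mapping.keys (h \<sigma>)" and i: "i \<in> \<sigma>" for \<sigma> w i
  proof -
    have wn: "w \<in> monomials n" using h \<sigma> w by auto
    have \<sigma>': "\<sigma> \<subseteq> {1..n}" "\<sigma> \<noteq> {}" using \<sigma> by (auto simp: faces_def)
    define j where "j = m (w + face_mon \<sigma>)"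
    have j: "j \<in> Poly_Mapping.keys (w + face_mon \<sigma>)"
      "j \<in> \<sigma> \<Longrightarrow> xpow (w + var j) \<in> I \<Longrightarrow> xpow (w + var i) \<in> I"
      using m \<sigma>' wn i unfolding pivot_def j_def by blast+
    have "Poly_Mapping.lookup (h \<sigma>) w \<noteq> 0" using w by (simp add: in_keys_iff)
    \<comment> \<open>A nonzero coefficient of \<open>h\<close> at \<open>w e_\<sigma>\<close> is,
      up to sign, the coefficient of x_j w e_{\<sigma> - {j}} in \<partial>f. As z is a cycle, that
      monomial x_j w lies in I.\<close>
    then have "j \<in> \<sigma>" "Poly_Mapping.lookup (poly_diff n p f (\<sigma> - {j})) (w + var j) \<noteq> 0"
      unfolding h_def b_def g_def lookup_diff_contraction[where m = m, OF f' \<sigma> wn j_def j(1)]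
      by (auto split: if_splits)
    then show ?thesis
      using z[unfolded zf reduce_mem_cycles_iff[OF f]] faces_remove[OF _ \<sigma>, of j] j(2)
      by (auto simp: in_keys_iff)
  qed
  have hs: "reduce (Suc p) h \<in> koszul_cycles Q x n (Suc p)"
    by (rule class_reduce_in_span(1)[OF h]) (rule hI)
  have "z = reduce (Suc p) (\<lambda>\<sigma>. h \<sigma> + b \<sigma>)" by (simp add: zf h_def)
  also have "\<dots> = reduce (Suc p) h \<oplus>\<^bsub>koszul_module Q n (Suc p)\<^esub> reduce (Suc p) b"
    using h b by (rule reduce_add)
  also have "reduce (Suc p) b = koszul_diff Q x n (Suc p) (reduce (Suc (Suc p)) g)"
    unfolding b_def by (rule koszul_diff_reduce[OF g', symmetric])
  \<comment> \<open>z and the reduction of \<open>h\<close> differ by the boundary of the reduced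
    contraction.\<close>
  finally have "cls (Suc p) z = cls (Suc p) (reduce (Suc p) h)"
    using class_add_boundary[OF hs] reduce_closed[OF g'] unfolding koszul_boundaries_def by blast
  also have "\<dots> \<in> LinearCombinations.module.span class_ring (homology n I (Suc p))
      (cls (Suc p) ` monomial_cycles n I (Suc p))"
    by (rule class_reduce_in_span(2)[OF h]) (rule hI)
  finally show ?thesis .
qed

text \<open>The classes of monomial cycles generate the homology, and a generating set contains a
  basis.\<close>

lemma pivot_imp_admits_monomial_basis:
  assumes m: "pivot m"
  shows "admits_monomial_basis n I"
  unfolding admits_monomial_basis_def
proof
  fix p assume "p \<in> {1..n}"
  \<comment> \<open>In positive homological degree all faces are nonempty, as \<open>pivot\<close>
    requires.\<close>
  then obtain q where p: "p = Suc q" by (cases p) auto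
  interpret V: vectorspace class_ring "homology n I p"
    by (rule vectorspace_homology[OF I.is_ideal])
  let ?G = "cls p ` monomial_cycles n I p"
  have G: "?G \<subseteq> carrier (homology n I p)"
    unfolding carrier_homology by (auto simp: monomial_cycles_def)
  have "V.span ?G = carrier (homology n I p)"
    using V.span_is_subset2[OF G] class_in_span[OF m, of _ q] unfolding p carrier_homology by blast
  then show "carrier (homology n I p) = {\<zero>\<^bsub>homology n I p\<^esub>} \<or>
      (\<exists>B. B \<subseteq> ?G \<and> V.basis B)"
    using V.basis_in_gen_set[OF G] by blast
qed

end

end

theorem corollary6p7:
  fixes n :: nat and I :: "'k::field mpoly set"
  assumes "I \<subseteq> ideal_prod (poly_ring n) (max_ideal n) (max_ideal n)"
    and "monomial_ideal n I"
    and "stable_ideal n I \<or> squarefree_stable_ideal n I"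
  shows "admits_monomial_basis n I"
proof -
  interpret monomial_ideal_quotient n I by standard (rule assms(2))
  show ?thesis
    using assms(3) stable_pivot squarefree_stable_pivot pivot_imp_admits_monomial_basis by blast
qed

end
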